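(* Let $E$ be a Banach lattice. The following assertions are equivalent: (1) $E$ is discrete and both $E$ and $E'$ are order continuous; (2) for every norm bounded net $(x_\alpha)\subset E$, the three conditions $x_\alpha\xrightarrow{un}0$, $x_\alpha\xrightarrow{uaw}0$, and $x_\alpha\to0$ weakly are equivalent to each other; (3) for every norm bounded sequence $(x_n)\subset E$, the three conditions $x_n\to 0$ weakly, $x_n\xrightarrow{uaw}0$, and $x_n\xrightarrow{un}0$ are equivalent to each other; (4) for every norm bounded net $(x_\alpha)\subset E$, $x_\alpha\xrightarrow{un}0$ if and only if $x_\alpha\to0$ weakly; (5) for every norm bounded sequence $(x_n)\subset E$, $x_n\xrightarrow{un}0$ if and only if $x_n\to0$ weakly.
   Context: $E^+$ denotes the positive cone of $E$ and $E'$ its norm dual, which is a Banach lattice. A Banach lattice is called order continuous if its norm is order continuous. A Banach lattice $E$ is discrete (atomic) if every nonzero positive element dominates an atom, where an atom is an element $a>0$ such that the order ideal generated by $a$ equals the linear span of $a$. A net (or sequence) $(x_\alpha)$ in $E$ is $un$-convergent to $x\in E$, written $x_\alpha\xrightarrow{un}x$, if $\big\||x_\alpha-x|\wedge u\big\|\to0$ for every $u\in E^+$; it is $uaw$-convergent to $x$, written $x_\alpha\xrightarrow{uaw}x$, if $|x_\alpha-x|\wedge u\to0$ weakly for every $u\in E^+$. *)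

theory Defs
  imports "HOL-Analysis.Analysis" "HOL-Library.Lattice_Algebras"
begin

text \<open>Here \<open>\<bar>x\<bar>\<close> is the lattice modulus \<open>sup x (- x)\<close>, by the axiom of the class
  \<open>lattice_ab_group_add_abs\<close>.\<close>

class banach_lattice = banach + ordered_real_vector + lattice_ab_group_add_abs +
  assumes norm_lattice_mono: "\<bar>x\<bar> \<le> \<bar>y\<bar> \<Longrightarrow> norm x \<le> norm y"

instance real :: banach_lattice
  by standard simp

text \<open>The order of bounded operators, and in particular of the norm dual \<open>'a \<Rightarrow>\<^sub>L real\<close>:
  \<open>f \<le> g\<close> iff \<open>g - f\<close> is positive.\<close>

instantiation blinfun :: (banach_lattice, "{real_normed_vector, order}") order
begin

definition less_eq_blinfun :: "('a \<Rightarrow>\<^sub>L 'b) \<Rightarrow> ('a \<Rightarrow>\<^sub>L 'b) \<Rightarrow> bool" where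
  "f \<le> g \<longleftrightarrow> (\<forall>x\<ge>0. blinfun_apply f x \<le> blinfun_apply g x)"

definition less_blinfun :: "('a \<Rightarrow>\<^sub>L 'b) \<Rightarrow> ('a \<Rightarrow>\<^sub>L 'b) \<Rightarrow> bool" where
  "f < g \<longleftrightarrow> f \<le> g \<and> \<not> g \<le> (f :: 'a \<Rightarrow>\<^sub>L 'b)"

instance
proof
  fix f g :: "'a \<Rightarrow>\<^sub>L 'b"
  assume fg: "f \<le> g" and gf: "g \<le> f"
  have pos: "blinfun_apply f x = blinfun_apply g x" if "0 \<le> x" for x
    using fg gf that by (simp add: less_eq_blinfun_def order_antisym)
  show "f = g"
  proof (rule blinfun_eqI)
    fix x :: 'a
    have x: "x = pprt x - (- nprt x)" using prts[of x] by simp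
    have "blinfun_apply f (pprt x) = blinfun_apply g (pprt x)"
      and "blinfun_apply f (- nprt x) = blinfun_apply g (- nprt x)"
      by (auto intro!: pos simp del: neg_0_le_iff_le simp: neg_0_le_iff_le[THEN iffD2])
    then show "blinfun_apply f x = blinfun_apply g x"
      by (subst (1 2) x) (simp only: blinfun.diff_right)
  qed
qed (auto simp: less_eq_blinfun_def less_blinfun_def intro: order_trans)

end

text \<open>A net is a family \<open>x\<close> indexed by a nonempty set \<open>I\<close> with a directed preorder \<open>le\<close>
  (\<open>le i j\<close>: the index \<open>j\<close> comes after \<open>i\<close>). Its convergence is convergence along the filter
  \<open>tails I le\<close> generated by the tails of \<open>I\<close>.\<close>

definition directed_set :: "'i set \<Rightarrow> ('i \<Rightarrow> 'i \<Rightarrow> bool) \<Rightarrow> bool" where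
  "directed_set I le \<longleftrightarrow> I \<noteq> {} \<and> reflp_on I le \<and> transp_on I le \<and>
     (\<forall>i\<in>I. \<forall>j\<in>I. \<exists>k\<in>I. le i k \<and> le j k)"

definition tails :: "'i set \<Rightarrow> ('i \<Rightarrow> 'i \<Rightarrow> bool) \<Rightarrow> 'i filter" where
  "tails I le = (INF i\<in>I. principal {j \<in> I. le i j})"

lemma eventually_tails:
  assumes "directed_set I le"
  shows "eventually P (tails I le) \<longleftrightarrow> (\<exists>i\<in>I. \<forall>j\<in>I. le i j \<longrightarrow> P j)"
proof -
  have "\<exists>k\<in>I. principal {l \<in> I. le k l} \<le> principal {l \<in> I. le i l} \<and>
      principal {l \<in> I. le k l} \<le> principal {l \<in> I. le j l}" if "i \<in> I" "j \<in> I" for i j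
  proof -
    obtain k where k: "k \<in> I" "le i k" "le j k"
      using assms \<open>i \<in> I\<close> \<open>j \<in> I\<close> by (auto simp: directed_set_def)
    have "le i l \<and> le j l" if "l \<in> I" "le k l" for l
      using assms k that \<open>i \<in> I\<close> \<open>j \<in> I\<close> unfolding directed_set_def
      by (meson transp_onD)
    then show ?thesis using k by auto
  qed
  then show ?thesis
    using assms unfolding tails_def directed_set_def
    by (subst eventually_INF_base) (auto simp: eventually_principal)
qed

lemma tails_UNIV_nat: "tails UNIV (\<le>) = (sequentially :: nat filter)"
proof -
  have "directed_set (UNIV :: nat set) (\<le>)"
    by (auto simp: directed_set_def reflp_on_def transp_on_def intro: max.cobounded1 max.cobounded2)
  then show ?thesis
    by (simp add: filter_eq_iff eventually_tails eventually_sequentially)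
qed

text \<open>The norm is order continuous if \<open>\<parallel>x\<^sub>\<alpha>\<parallel> \<rightarrow> 0\<close> for every net \<open>x\<^sub>\<alpha> \<down> 0\<close>. The range \<open>D\<close> of a
  decreasing net is directed downwards, and, the net being decreasing, it suffices to consider
  such a set \<open>D\<close> as a net indexed by itself; this avoids a quantification over index types.\<close>

definition order_continuous_norm :: "'a::{real_normed_vector, order} itself \<Rightarrow> bool" where
  "order_continuous_norm _ \<longleftrightarrow>
     (\<forall>D :: 'a set. directed_set D (\<ge>) \<and>
        (\<forall>d\<in>D. 0 \<le> d) \<and> (\<forall>b. (\<forall>d\<in>D. b \<le> d) \<longrightarrow> b \<le> 0) \<longrightarrow>
        (norm \<longlongrightarrow> 0) (tails D (\<ge>)))"

definition order_ideal :: "'a::banach_lattice set \<Rightarrow> bool" where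
  "order_ideal J \<longleftrightarrow> subspace J \<and> (\<forall>x\<in>J. \<forall>y. \<bar>y\<bar> \<le> \<bar>x\<bar> \<longrightarrow> y \<in> J)"

definition lattice_atom :: "'a::banach_lattice \<Rightarrow> bool" where
  "lattice_atom a \<longleftrightarrow> 0 < a \<and> order_ideal hull {a} = span {a}"

definition discrete_lattice :: "'a::banach_lattice itself \<Rightarrow> bool" where
  "discrete_lattice _ \<longleftrightarrow> (\<forall>x::'a. 0 < x \<longrightarrow> (\<exists>a. lattice_atom a \<and> a \<le> x))"

definition weak_tendsto :: "('i \<Rightarrow> 'a::real_normed_vector) \<Rightarrow> 'a \<Rightarrow> 'i filter \<Rightarrow> bool" where
  "weak_tendsto x l F \<longleftrightarrow>
     (\<forall>f :: 'a \<Rightarrow>\<^sub>L real. ((\<lambda>i. blinfun_apply f (x i)) \<longlongrightarrow> blinfun_apply f l) F)"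

definition un_tendsto :: "('i \<Rightarrow> 'a::banach_lattice) \<Rightarrow> 'a \<Rightarrow> 'i filter \<Rightarrow> bool" where
  "un_tendsto x l F \<longleftrightarrow> (\<forall>u\<ge>0. ((\<lambda>i. norm (inf \<bar>x i - l\<bar> u)) \<longlongrightarrow> 0) F)"

definition uaw_tendsto :: "('i \<Rightarrow> 'a::banach_lattice) \<Rightarrow> 'a \<Rightarrow> 'i filter \<Rightarrow> bool" where
  "uaw_tendsto x l F \<longleftrightarrow> (\<forall>u\<ge>0. weak_tendsto (\<lambda>i. inf \<bar>x i - l\<bar> u) 0 F)"

definition all_equivalent :: "bool list \<Rightarrow> bool" where
  "all_equivalent ps \<longleftrightarrow> (\<forall>p\<in>set ps. \<forall>q\<in>set ps. p \<longleftrightarrow> q)"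

text \<open>A formula cannot quantify over the type of the index sets of nets. A statement about all nets
  in \<open>'a\<close> is therefore made for all nets whose index set is contained in a type \<open>'i\<close>, which is an
  arbitrary (universally quantified) infinite type of the theorem. Every directed set is then
  covered by a suitable instance of \<open>'i\<close>. A finite type \<open>'i\<close> would not do: a finite directed
  set has an index that comes after all others, so the convergence statements collapse to
  \<open>x i = 0\<close> at that index. An infinite \<open>'i\<close> has room for all sequences.\<close>

end

theory Submission
  imports Defs
begin

text \<open>
  In a discrete lattice with order continuous norm every \<open>u \<ge> 0\<close> is, up to small norm, dominated
  by a finite sum of atoms, so \<open>\<bar>x\<^sub>\<alpha>\<bar> \<sqinter> u\<close> tends to \<open>0\<close> in norm as soon as \<open>\<bar>x\<^sub>\<alpha>\<bar> \<sqinter> a\<close> does for each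
  atom \<open>a\<close>; weak convergence gives the latter, because the coordinate at \<open>a\<close> is a bounded
  functional. Order continuity of the dual makes every positive functional \<open>f\<close> tight: for some
  \<open>u\<close> the values \<open>f ((x - u)\<^sup>+)\<close> are uniformly small on the positive part of the unit ball. This turns
  bounded un-convergence into weak convergence.

  Conversely, positive sequences with order bounded partial sums are weakly null. If weak
  convergence implies un-convergence, they are norm null, hence decreasing positive sequences
  converge and the norm is order continuous. Bounded disjoint sequences are then un-null, so if
  un-convergence implies weak convergence they are weakly null, which yields tightness and order
  continuity of the dual norm. If some \<open>x > 0\<close> dominated no atom, there would be \<open>0 < u \<le> x\<close> and a
  positive functional \<open>f\<close> that is strictly positive on \<open>[0, u]\<close>. Components of \<open>u\<close> can then be split
  into halves of equal \<open>f\<close>-measure, and the resulting Rademacher sequence \<open>r\<^sub>n\<close> with \<open>\<bar>r\<^sub>n\<bar> = u\<close> is weakly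
  null but not un-null. No form of the Hahn-Banach theorem enters: the hypothesis applied to a
  constant sequence provides a functional that does not vanish at \<open>x\<close>.
\<close>

subsection \<open>Lattice inequalities and positive functionals\<close>

lemma norm_abs [simp]: "norm \<bar>x\<bar> = norm (x :: 'a::banach_lattice)"
  by (rule antisym; rule norm_lattice_mono) simp_all

lemma norm_mono_nonneg:
  fixes x y :: "'a::banach_lattice"
  shows "0 \<le> x \<Longrightarrow> x \<le> y \<Longrightarrow> norm x \<le> norm y"
  by (rule norm_lattice_mono) simp

text \<open>The positive part of \<open>b - l\<close> is dominated by
  \<open>\<bar>X n - l\<bar>\<close>, so its norm vanishes.\<close>

lemma lattice_LIMSEQ_ge_from:
  fixes X :: "nat \<Rightarrow> 'a::banach_lattice"
  assumes lim: "X \<longlonglongrightarrow> l" and le: "\<And>n. N \<le> n \<Longrightarrow> b \<le> X n"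
  shows "b \<le> l"
proof -
  have "(\<lambda>n. norm (X n - l)) \<longlonglongrightarrow> 0"
    using lim by (simp add: LIM_zero tendsto_norm_zero)
  moreover have "\<forall>n\<ge>N. norm (pprt (b - l)) \<le> norm (X n - l)"
  proof (intro allI impI)
    fix n assume "N \<le> n"
    have "b - l \<le> \<bar>X n - l\<bar>"
      using le[OF \<open>N \<le> n\<close>] by (meson abs_ge_self diff_right_mono order_trans)
    then have "pprt (b - l) \<le> \<bar>X n - l\<bar>"
      by (simp add: pprt_def)
    then show "norm (pprt (b - l)) \<le> norm (X n - l)"
      by (intro norm_lattice_mono) (simp add: pprt_def)
  qed
  ultimately have "norm (pprt (b - l)) \<le> 0"
    by (meson LIMSEQ_le_const)
  then show ?thesis
    by (simp add: le_zero_iff_zero_pprt[symmetric])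
qed

lemma lattice_LIMSEQ_ge:
  fixes X :: "nat \<Rightarrow> 'a::banach_lattice"
  assumes "X \<longlonglongrightarrow> l" "\<And>n. b \<le> X n"
  shows "b \<le> l"
  using lattice_LIMSEQ_ge_from[OF assms(1), of 0] assms(2) by simp

lemma lattice_LIMSEQ_le:
  fixes X :: "nat \<Rightarrow> 'a::banach_lattice"
  assumes "X \<longlonglongrightarrow> l" and "\<And>n. X n \<le> b"
  shows "l \<le> b"
  using lattice_LIMSEQ_ge[OF tendsto_minus[OF assms(1)], of "- b"] assms(2) by simp

lemma pprt_diff_pprt: "pprt x - pprt (- x) = (x :: 'a::banach_lattice)"
  by (simp add: pprt_neg flip: prts)

lemma pprt_add_pprt: "pprt x + pprt (- x) = \<bar>x :: 'a::banach_lattice\<bar>"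
  by (simp add: pprt_neg abs_prts)

text \<open>Cuts \<open>x\<close> at the level \<open>y\<close> into a part below \<open>y\<close>
  and an excess; this serves as the Riesz decomposition in what follows.\<close>

lemma inf_add_pprt_diff: "inf x y + pprt (x - y) = (x :: 'a::banach_lattice)"
proof -
  have "sup x y = y + pprt (x - y)" by (simp add: pprt_def add_sup_distrib_left)
  then have "x + y = y + (pprt (x - y) + inf x y)"
    using add_eq_inf_sup[of x y] by (simp only: add.assoc)
  then show ?thesis by (metis add.commute add_left_cancel)
qed

text \<open>The excess of \<open>inf x (y + z)\<close> over \<open>y\<close> lies below both
  \<open>x\<close> and \<open>z\<close>; cutting at \<open>y\<close> gives the bound.\<close>

lemma inf_add_le:
  fixes x y z :: "'a::banach_lattice"
  assumes "0 \<le> x" "0 \<le> y" "0 \<le> z"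
  shows "inf x (y + z) \<le> inf x y + inf x z"
proof -
  let ?w = "inf x (y + z)"
  have w: "?w \<le> x" "?w \<le> y + z" by simp_all
  have "?w - y \<le> z" using w(2) by (simp only: diff_le_eq add.commute)
  moreover have "?w - y \<le> x"
  proof -
    have "?w - y \<le> ?w" using \<open>0 \<le> y\<close> by (simp only: diff_le_eq le_add_same_cancel1)
    then show ?thesis using w(1) by (rule order_trans)
  qed
  ultimately have "pprt (?w - y) \<le> inf x z"
    unfolding pprt_def using assms by (intro le_supI le_infI)
  moreover have "inf ?w y \<le> inf x y" using w(1) by (rule inf_mono) simp
  ultimately show ?thesis using add_mono inf_add_pprt_diff[of ?w y] by metis
qed

text \<open>Natural multiples follow by induction from \<open>inf_add_le\<close>, and
  \<open>c\<close> is below some natural number.\<close>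

lemma inf_scaleR_eq_0:
  fixes x w :: "'a::banach_lattice"
  assumes "0 \<le> x" "0 \<le> w" and disj: "inf x w = 0" and "0 \<le> c"
  shows "inf x (c *\<^sub>R w) = 0"
proof -
  have nat: "inf x (real n *\<^sub>R w) = 0" for n
  proof (induction n)
    case (Suc n)
    have "inf x (real (Suc n) *\<^sub>R w) \<le> inf x w + inf x (real n *\<^sub>R w)"
      using inf_add_le[of x w "real n *\<^sub>R w"] assms by (simp add: scaleR_add_left scaleR_nonneg_nonneg)
    also have "\<dots> = 0" using Suc disj by simp
    finally show ?case using assms by (intro antisym) (auto intro: scaleR_nonneg_nonneg)
  qed (use assms in \<open>simp add: inf_absorb2\<close>)
  obtain n where n: "c \<le> real n" using real_arch_simple by blast
  have "inf x (c *\<^sub>R w) \<le> inf x (real n *\<^sub>R w)"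
    using n assms by (intro inf_mono scaleR_right_mono) auto
  then show ?thesis
    using nat[of n] assms by (intro antisym) (auto intro: scaleR_nonneg_nonneg)
qed

lemma inf_sum_eq_0:
  fixes f :: "'i \<Rightarrow> 'a::banach_lattice"
  assumes "0 \<le> x" "\<And>i. i \<in> A \<Longrightarrow> 0 \<le> f i" "\<And>i. i \<in> A \<Longrightarrow> inf x (f i) = 0"
  shows "inf x (sum f A) = 0"
  using assms(2,3)
proof (induction A rule: infinite_finite_induct)
  case (insert i A)
  have "inf x (sum f (insert i A)) \<le> inf x (f i) + inf x (sum f A)"
    using insert inf_add_le[of x "f i" "sum f A"] \<open>0 \<le> x\<close> by (simp add: sum_nonneg)
  also have "\<dots> = 0" using insert by simp
  finally show ?case
    using insert.prems \<open>0 \<le> x\<close> by (intro antisym) (auto intro!: sum_nonneg)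
qed (use \<open>0 \<le> x\<close> in \<open>simp_all add: inf_absorb2\<close>)

text \<open>For disjoint elements the sum is the supremum, since the infimum in
  \<open>add_eq_inf_sup\<close> vanishes.\<close>

lemma sum_disjoint_le:
  fixes f :: "'i \<Rightarrow> 'a::banach_lattice"
  assumes "0 \<le> x" "finite A" "\<And>i. i \<in> A \<Longrightarrow> 0 \<le> f i" "\<And>i. i \<in> A \<Longrightarrow> f i \<le> x"
    and "\<And>i j. i \<in> A \<Longrightarrow> j \<in> A \<Longrightarrow> i \<noteq> j \<Longrightarrow> inf (f i) (f j) = 0"
  shows "sum f A \<le> x"
  using assms(2-5)
proof (induction A)
  case (insert i A)
  have "inf (f i) (sum f A) = 0"
    using insert by (intro inf_sum_eq_0) auto
  then have "f i + sum f A = sup (f i) (sum f A)"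
    using add_eq_inf_sup[of "f i" "sum f A"] by simp
  also have "\<dots> \<le> x" using insert by simp
  finally show ?case using insert by simp
qed (use \<open>0 \<le> x\<close> in simp)

text \<open>Cauchy's functional equation: the defect \<open>h\<close> is additive and vanishes at
  the natural numbers, so passing to fractional parts bounds it by \<open>\<phi> x\<close>. A
  bounded additive function is zero, because \<open>h (n * c) = n * h c\<close>.\<close>

lemma additive_homogeneous:
  fixes \<phi> :: "'a::banach_lattice \<Rightarrow> real"
  assumes add: "\<And>x y. 0 \<le> x \<Longrightarrow> 0 \<le> y \<Longrightarrow> \<phi> (x + y) = \<phi> x + \<phi> y"
    and nonneg: "\<And>x. 0 \<le> x \<Longrightarrow> 0 \<le> \<phi> x"
    and x: "0 \<le> x" and "0 \<le> c"
  shows "\<phi> (c *\<^sub>R x) = c * \<phi> x"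
proof -
  define h where "h t = \<phi> (t *\<^sub>R x) - t * \<phi> x" for t
  have h_add: "h (s + t) = h s + h t" if "0 \<le> s" "0 \<le> t" for s t
    using that x by (simp add: h_def scaleR_add_left add scaleR_nonneg_nonneg algebra_simps)
  have h_nat: "h (real n * t) = real n * h t" if "0 \<le> t" for n t
  proof (induction n)
    case 0
    show ?case using h_add[of 0 0] by simp
  next
    case (Suc n)
    then show ?case using h_add[of t "real n * t"] that by (simp add: algebra_simps)
  qed
  have h_bound: "\<bar>h t\<bar> \<le> \<phi> x" if "0 \<le> t" for t
  proof -
    let ?r = "t - real (nat \<lfloor>t\<rfloor>)"
    have r: "0 \<le> ?r" "?r \<le> 1" using that by linarith+
    have "h t = h (real (nat \<lfloor>t\<rfloor>)) + h ?r"
      using h_add[of "real (nat \<lfloor>t\<rfloor>)" ?r] r by simp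
    moreover have "h (real (nat \<lfloor>t\<rfloor>)) = 0"
      using h_nat[of 1 "nat \<lfloor>t\<rfloor>"] by (simp add: h_def)
    moreover have "\<phi> (?r *\<^sub>R x) + \<phi> ((1 - ?r) *\<^sub>R x) = \<phi> x"
      using add[of "?r *\<^sub>R x" "(1 - ?r) *\<^sub>R x"] r x
      by (simp add: scaleR_nonneg_nonneg flip: scaleR_add_left)
    moreover have "0 \<le> \<phi> (?r *\<^sub>R x)" "0 \<le> \<phi> ((1 - ?r) *\<^sub>R x)"
      using r x by (auto intro!: nonneg scaleR_nonneg_nonneg)
    moreover have "0 \<le> ?r * \<phi> x" "?r * \<phi> x \<le> \<phi> x"
      using r nonneg[OF x] by (auto intro: mult_left_le_one_le)
    ultimately show ?thesis unfolding h_def by linarith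
  qed
  have "h c = 0"
  proof (rule ccontr)
    assume "h c \<noteq> 0"
    then obtain n where "\<phi> x < real n * \<bar>h c\<bar>"
      using reals_Archimedean3[of "\<bar>h c\<bar>"] by auto
    then have "\<phi> x < \<bar>h (real n * c)\<bar>"
      using h_nat[OF \<open>0 \<le> c\<close>, of n] by (simp add: abs_mult)
    then show False
      using h_bound[of "real n * c"] \<open>0 \<le> c\<close> by simp
  qed
  then show ?thesis by (simp add: h_def)
qed

text \<open>Kantorovich's extension: every \<open>x\<close> is a difference of positive elements,
  and additivity makes \<open>\<phi> a - \<phi> b\<close> independent of the representation
  \<open>x = a - b\<close>.\<close>

lemma positive_extension:
  fixes \<phi> :: "'a::banach_lattice \<Rightarrow> real"
  assumes add: "\<And>x y. 0 \<le> x \<Longrightarrow> 0 \<le> y \<Longrightarrow> \<phi> (x + y) = \<phi> x + \<phi> y"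
    and nonneg: "\<And>x. 0 \<le> x \<Longrightarrow> 0 \<le> \<phi> x"
    and bound: "\<And>x. 0 \<le> x \<Longrightarrow> \<phi> x \<le> C * norm x"
  obtains F :: "'a \<Rightarrow>\<^sub>L real" where "\<And>x. 0 \<le> x \<Longrightarrow> blinfun_apply F x = \<phi> x"
proof -
  note hom = additive_homogeneous[where \<phi> = \<phi>, OF add nonneg]
  define F where "F x = \<phi> (pprt x) - \<phi> (pprt (- x))" for x
  have F: "F x = \<phi> a - \<phi> b" if "0 \<le> a" "0 \<le> b" "x = a - b" for x a b
  proof -
    have "pprt x + b = a + pprt (- x)"
      using pprt_diff_pprt[of x] that(3) by (metis diff_add_eq diff_diff_eq2 diff_eq_eq add.commute)
    then have "\<phi> (pprt x) + \<phi> b = \<phi> a + \<phi> (pprt (- x))"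
      using that by (simp only: add[symmetric] zero_le_pprt)
    then show ?thesis by (simp add: F_def)
  qed
  have "bounded_linear F"
  proof (rule bounded_linear_intro)
    fix x y :: 'a
    have "x + y = pprt x + pprt y - (pprt (- x) + pprt (- y))"
      using pprt_diff_pprt[of x] pprt_diff_pprt[of y] by (simp only: add_diff_add)
    then have "F (x + y) = \<phi> (pprt x + pprt y) - \<phi> (pprt (- x) + pprt (- y))"
      by (intro F add_nonneg_nonneg zero_le_pprt)
    then show "F (x + y) = F x + F y"
      by (simp add: add F_def)
  next
    fix r :: real and x :: 'a
    show "F (r *\<^sub>R x) = r *\<^sub>R F x"
    proof (cases "0 \<le> r")
      case True
      have "r *\<^sub>R x = r *\<^sub>R pprt x - r *\<^sub>R pprt (- x)"
        by (simp only: pprt_diff_pprt flip: scaleR_diff_right)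
      then have "F (r *\<^sub>R x) = \<phi> (r *\<^sub>R pprt x) - \<phi> (r *\<^sub>R pprt (- x))"
        using True by (intro F scaleR_nonneg_nonneg zero_le_pprt)
      then show ?thesis
        using True by (simp add: hom F_def right_diff_distrib)
    next
      case False
      have "r *\<^sub>R x = (- r) *\<^sub>R pprt (- x) - (- r) *\<^sub>R pprt x"
        by (simp add: pprt_diff_pprt flip: scaleR_diff_right)
      then have "F (r *\<^sub>R x) = \<phi> ((- r) *\<^sub>R pprt (- x)) - \<phi> ((- r) *\<^sub>R pprt x)"
        using False by (intro F scaleR_nonneg_nonneg zero_le_pprt) simp_all
      also have "\<dots> = - r * \<phi> (pprt (- x)) - (- r) * \<phi> (pprt x)"
        using False by (subst (1 2) hom) simp_all
      finally show ?thesis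
        by (simp add: F_def algebra_simps)
    qed
  next
    fix x :: 'a
    have "\<bar>F x\<bar> \<le> \<phi> (pprt x) + \<phi> (pprt (- x))"
      using nonneg[of "pprt x"] nonneg[of "pprt (- x)"] by (simp add: F_def)
    also have "\<dots> = \<phi> \<bar>x\<bar>"
      by (simp flip: add pprt_add_pprt)
    also have "\<dots> \<le> C * norm x" using bound[of "\<bar>x\<bar>"] by simp
    finally show "norm (F x) \<le> norm x * C" by (simp add: mult.commute)
  qed
  then have "blinfun_apply (Blinfun F) x = \<phi> x" if "0 \<le> x" for x
    using F[of x 0 x] that add[of 0 0] by (simp add: bounded_linear_Blinfun_apply)
  then show thesis by (rule that)
qed


lemma inf_pprt_pprt: "inf (pprt z) (pprt (- z)) = (0 :: 'a::banach_lattice)"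
proof -
  have "inf (pprt z) (pprt (- z)) = pprt (- z) + inf (pprt z - pprt (- z)) 0"
    unfolding add_inf_distrib_left by simp
  also have "\<dots> = pprt (- z) + nprt z"
    by (simp only: pprt_diff_pprt nprt_def)
  finally show ?thesis by (simp add: pprt_neg)
qed

lemma inf_eq_0_mono:
  fixes x y :: "'a::banach_lattice"
  assumes "inf x y = 0" "0 \<le> x'" "x' \<le> x" "0 \<le> y'" "y' \<le> y"
  shows "inf x' y' = 0"
  using assms by (metis antisym inf_mono le_inf_iff)

section \<open>Positive functionals, positive parts and moduli in the dual\<close>

lemma pos_blinfun_iff: "(0 :: 'a::banach_lattice \<Rightarrow>\<^sub>L real) \<le> f \<longleftrightarrow> (\<forall>x\<ge>0. 0 \<le> blinfun_apply f x)"
  by (simp add: less_eq_blinfun_def)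

lemma pos_blinfun_nonneg: "(0 :: 'a::banach_lattice \<Rightarrow>\<^sub>L real) \<le> f \<Longrightarrow> 0 \<le> x \<Longrightarrow> 0 \<le> blinfun_apply f x"
  by (simp add: pos_blinfun_iff)

lemma pos_blinfun_mono:
  fixes f :: "'a::banach_lattice \<Rightarrow>\<^sub>L real"
  shows "0 \<le> f \<Longrightarrow> x \<le> y \<Longrightarrow> blinfun_apply f x \<le> blinfun_apply f y"
  using pos_blinfun_nonneg[of f "y - x"] by (simp add: blinfun.diff_right)

lemma pos_blinfun_abs:
  fixes f :: "'a::banach_lattice \<Rightarrow>\<^sub>L real"
  assumes "0 \<le> f"
  shows "\<bar>blinfun_apply f x\<bar> \<le> blinfun_apply f \<bar>x\<bar>"
  using pos_blinfun_mono[OF assms abs_ge_self[of x]] pos_blinfun_mono[OF assms abs_ge_minus_self[of x]]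
  by (simp add: blinfun.minus_right)

lemma blinfun_bound: "blinfun_apply f x \<le> norm f * norm x" for f :: "'a::real_normed_vector \<Rightarrow>\<^sub>L real"
  using norm_blinfun[of f x] by simp

text \<open>The Riesz-Kantorovich formula: at \<open>x \<ge> 0\<close> the positive part of
  \<open>f\<close> is the supremum of \<open>f\<close> over \<open>{0..x}\<close>. The last property
  records that this value is the least upper bound.\<close>

lemma positive_part_blinfun:
  fixes f :: "'a::banach_lattice \<Rightarrow>\<^sub>L real"
  obtains p :: "'a \<Rightarrow>\<^sub>L real" where "0 \<le> p" "f \<le> p"
    and "\<And>x c. 0 \<le> x \<Longrightarrow> (\<And>y. 0 \<le> y \<Longrightarrow> y \<le> x \<Longrightarrow> blinfun_apply f y \<le> c) \<Longrightarrow> blinfun_apply p x \<le> c"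
proof -
  define \<phi> where "\<phi> x = (SUP y\<in>{0..x}. blinfun_apply f y)" for x
  have bnd: "blinfun_apply f y \<le> norm f * norm x" if "0 \<le> y" "y \<le> x" for x y
  proof -
    have "blinfun_apply f y \<le> norm f * norm y" by (rule blinfun_bound)
    also have "\<dots> \<le> norm f * norm x" using that by (intro mult_left_mono norm_mono_nonneg) auto
    finally show ?thesis .
  qed
  then have bdd: "bdd_above (blinfun_apply f ` {0..x})" for x
    by (intro bdd_aboveI2) auto
  have ge: "blinfun_apply f y \<le> \<phi> x" if "0 \<le> y" "y \<le> x" for x y
    unfolding \<phi>_def using that by (intro cSUP_upper bdd) auto
  have le: "\<phi> x \<le> c" if "0 \<le> x" "\<And>y. 0 \<le> y \<Longrightarrow> y \<le> x \<Longrightarrow> blinfun_apply f y \<le> c" for x c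
    unfolding \<phi>_def using that by (intro cSUP_least) auto
  obtain p where p: "\<And>x. 0 \<le> x \<Longrightarrow> blinfun_apply p x = \<phi> x"
  proof (rule positive_extension[of \<phi> "norm f"])
    fix x z :: 'a
    assume xz: "0 \<le> x" "0 \<le> z"
    show "\<phi> (x + z) = \<phi> x + \<phi> z"
    proof (rule antisym)
      show "\<phi> (x + z) \<le> \<phi> x + \<phi> z"
      proof (rule le)
        fix y assume y: "0 \<le> y" "y \<le> x + z"
        \<comment> \<open>Riesz decomposition: \<open>y\<close> splits into a part below
          \<open>x\<close> and an excess below \<open>z\<close>.\<close>
        have "blinfun_apply f y = blinfun_apply f (inf y x) + blinfun_apply f (pprt (y - x))"
          by (simp only: inf_add_pprt_diff flip: blinfun.add_right)
        also have "\<dots> \<le> \<phi> x + \<phi> z"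
          using y xz by (intro add_mono ge) (auto simp: pprt_def algebra_simps)
        finally show "blinfun_apply f y \<le> \<phi> x + \<phi> z" .
      qed (use xz in simp)
      have "\<phi> x \<le> \<phi> (x + z) - \<phi> z"
      proof (rule le[OF xz(1)])
        fix y assume y: "0 \<le> y" "y \<le> x"
        have "\<phi> z \<le> \<phi> (x + z) - blinfun_apply f y"
        proof (rule le[OF xz(2)])
          fix y' assume y': "0 \<le> y'" "y' \<le> z"
          have "blinfun_apply f (y + y') \<le> \<phi> (x + z)"
            using y y' by (intro ge add_mono) auto
          then show "blinfun_apply f y' \<le> \<phi> (x + z) - blinfun_apply f y"
            by (simp add: blinfun.add_right)
        qed
        then show "blinfun_apply f y \<le> \<phi> (x + z) - \<phi> z" by simp
      qed
      then show "\<phi> x + \<phi> z \<le> \<phi> (x + z)" by simp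
    qed
  next
    fix x :: 'a assume "0 \<le> x"
    then show "0 \<le> \<phi> x" using ge[of 0 x] by simp
    show "\<phi> x \<le> norm f * norm x" using \<open>0 \<le> x\<close> by (intro le bnd)
  qed blast
  show thesis
  proof
    show "0 \<le> p" using p ge[of 0] by (simp add: pos_blinfun_iff)
    show "f \<le> p" using p ge by (simp add: less_eq_blinfun_def)
    show "blinfun_apply p x \<le> c"
      if "0 \<le> x" "\<And>y. 0 \<le> y \<Longrightarrow> y \<le> x \<Longrightarrow> blinfun_apply f y \<le> c" for x c
      using p le that by simp
  qed
qed

text \<open>A positive majorant of \<open>f\<close> plus one of \<open>- f\<close> takes the place
  of the modulus of \<open>f\<close>; the bound passes from the cone to all \<open>x\<close> through
  positive and negative parts.\<close>

lemma modulus_majorant: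
  fixes f :: "'a::banach_lattice \<Rightarrow>\<^sub>L real"
  obtains g :: "'a \<Rightarrow>\<^sub>L real" where "0 \<le> g" "\<And>x. \<bar>blinfun_apply f x\<bar> \<le> blinfun_apply g \<bar>x\<bar>"
proof -
  obtain p where p: "0 \<le> p" "f \<le> p" by (rule positive_part_blinfun)
  obtain q where q: "0 \<le> q" "- f \<le> q" by (rule positive_part_blinfun)
  have *: "\<bar>blinfun_apply f x\<bar> \<le> blinfun_apply (p + q) x" if "0 \<le> x" for x
    using p q that by (fastforce simp: less_eq_blinfun_def blinfun.add_left blinfun.minus_left abs_le_iff)
  show thesis
  proof
    show "0 \<le> p + q"
      using p(1) q(1) by (simp add: pos_blinfun_iff blinfun.add_left)
    fix x
    have "\<bar>blinfun_apply f x\<bar> = \<bar>blinfun_apply f (pprt x) - blinfun_apply f (pprt (- x))\<bar>"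
      by (simp only: pprt_diff_pprt flip: blinfun.diff_right)
    also have "\<dots> \<le> blinfun_apply (p + q) (pprt x) + blinfun_apply (p + q) (pprt (- x))"
      using *[of "pprt x"] *[of "pprt (- x)"] by simp
    also have "\<dots> = blinfun_apply (p + q) \<bar>x\<bar>"
      by (simp only: pprt_add_pprt flip: blinfun.add_right)
    finally show "\<bar>blinfun_apply f x\<bar> \<le> blinfun_apply (p + q) \<bar>x\<bar>" .
  qed
qed

lemma weak_null_majorant:
  fixes y :: "'i \<Rightarrow> 'a::banach_lattice"
  assumes "\<And>g :: 'a \<Rightarrow>\<^sub>L real. 0 \<le> g \<Longrightarrow> ((\<lambda>i. blinfun_apply g \<bar>y i\<bar>) \<longlongrightarrow> 0) F"
  shows "weak_tendsto y 0 F"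
  unfolding weak_tendsto_def
proof
  fix f :: "'a \<Rightarrow>\<^sub>L real"
  obtain g where g: "0 \<le> g" "\<And>x. \<bar>blinfun_apply f x\<bar> \<le> blinfun_apply g \<bar>x\<bar>"
    by (rule modulus_majorant) blast
  have "((\<lambda>i. blinfun_apply f (y i)) \<longlongrightarrow> 0) F"
    by (rule Lim_null_comparison[OF always_eventually assms[OF g(1)]]) (simp add: g(2))
  then show "((\<lambda>i. blinfun_apply f (y i)) \<longlongrightarrow> blinfun_apply f 0) F"
    by (simp add: blinfun.zero_right)
qed

text \<open>The values form a series of nonnegative terms with partial sums at most
  \<open>g u\<close>.\<close>

lemma pos_blinfun_sum_bounded:
  fixes y :: "nat \<Rightarrow> 'a::banach_lattice"
  assumes "0 \<le> (g :: 'a \<Rightarrow>\<^sub>L real)" and "\<And>n. 0 \<le> y n" "\<And>N. sum y {..<N} \<le> u"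
  shows "(\<lambda>n. blinfun_apply g (y n)) \<longlonglongrightarrow> 0"
proof (intro summable_LIMSEQ_zero bounded_imp_summable)
  show "0 \<le> blinfun_apply g (y n)" for n
    using assms pos_blinfun_nonneg by blast
  show "sum (\<lambda>n. blinfun_apply g (y n)) {..n} \<le> blinfun_apply g u" for n
    using pos_blinfun_mono[OF assms(1) assms(3)[of "Suc n"]]
    by (simp add: lessThan_Suc_atMost blinfun.sum_right)
qed

lemma weak_null_sum_bounded:
  fixes y :: "nat \<Rightarrow> 'a::banach_lattice"
  assumes "\<And>n. 0 \<le> y n" "\<And>N. sum y {..<N} \<le> u"
  shows "weak_tendsto y 0 sequentially"
  by (rule weak_null_majorant) (use assms in \<open>simp add: pos_blinfun_sum_bounded[where u = u]\<close>)

lemma pprt_le_add: "0 \<le> b \<Longrightarrow> pprt a \<le> pprt (a - b) + (b :: 'a::banach_lattice)"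
  unfolding pprt_def add_sup_distrib_right by (simp add: le_supI2)

subsection \<open>Tightness and order continuity\<close>

text \<open>If \<open>f\<close> is not tight, choose \<open>x\<^sub>n\<close> in the positive unit ball with
  \<open>f ((x\<^sub>n - 4^n s\<^sub>n)\<^sup>+) > e\<close> for \<open>s\<^sub>n = \<Sum>k<n. x\<^sub>k\<close>. With \<open>v = \<Sum>n. 2^-n x\<^sub>n\<close>, the elements
  \<open>(x\<^sub>n - 4^n s\<^sub>n - 2^-n v)\<^sup>+\<close> are pairwise disjoint, and \<open>f\<close> stays away from \<open>0\<close> on them.\<close>

lemma pos_blinfun_tight:
  fixes f :: "'a::banach_lattice \<Rightarrow>\<^sub>L real"
  assumes f: "0 \<le> f" and "0 < e"
    and disj: "\<And>w :: nat \<Rightarrow> 'a. (\<And>n. 0 \<le> w n) \<Longrightarrow> (\<And>n. norm (w n) \<le> 1) \<Longrightarrow>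
      (\<And>m n. m \<noteq> n \<Longrightarrow> inf (w m) (w n) = 0) \<Longrightarrow> (\<lambda>n. blinfun_apply f (w n)) \<longlonglongrightarrow> 0"
  obtains u where "0 \<le> u"
    and "\<And>x. 0 \<le> x \<Longrightarrow> norm x \<le> 1 \<Longrightarrow> blinfun_apply f (pprt (x - u)) \<le> e"
proof (rule ccontr)
  assume "\<not> thesis"
  then have "\<forall>u. \<exists>x. 0 \<le> u \<longrightarrow> 0 \<le> x \<and> norm x \<le> 1 \<and> e < blinfun_apply f (pprt (x - u))"
    using that by (meson not_le)
  then obtain P where P: "\<And>u. 0 \<le> u \<Longrightarrow> 0 \<le> P u" "\<And>u. 0 \<le> u \<Longrightarrow> norm (P u) \<le> 1"
    "\<And>u. 0 \<le> u \<Longrightarrow> e < blinfun_apply f (pprt (P u - u))"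
    by metis
  \<comment> \<open>The failure of tightness is applied at \<open>4 ^ n *\<^sub>R s n\<close>, which
    depends only on earlier choices; the recursion therefore runs over the partial sums.\<close>
  define s where "s = rec_nat 0 (\<lambda>n t. t + P (4 ^ n *\<^sub>R t))"
  define x where "x n = P (4 ^ n *\<^sub>R s n)" for n
  have s_Suc: "s (Suc n) = s n + x n" for n by (simp add: s_def x_def)
  have s0: "0 \<le> s n" for n
  proof (induction n)
    case (Suc n)
    then show ?case using P(1)[of "4 ^ n *\<^sub>R s n"] by (simp add: s_Suc x_def scaleR_nonneg_nonneg)
  qed (simp add: s_def)
  have x: "0 \<le> x n" "norm (x n) \<le> 1" "e < blinfun_apply f (pprt (x n - 4 ^ n *\<^sub>R s n))" for n
    using P[of "4 ^ n *\<^sub>R s n"] s0[of n] by (simp_all add: x_def scaleR_nonneg_nonneg)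
  have s_ge: "x n \<le> s m" if "n < m" for n m
    using that
  proof (induction m)
    case (Suc m)
    show ?case
    proof (cases "n = m")
      case False
      then show ?thesis using Suc x(1)[of m] by (simp add: s_Suc add_increasing2)
    qed (use s0 in \<open>simp add: s_Suc\<close>)
  qed simp
  define v where "v = (\<Sum>n. (1/2) ^ n *\<^sub>R x n)"
  have summ: "summable (\<lambda>n. (1/2) ^ n *\<^sub>R x n)"
    using x(2) by (intro summable_comparison_test'[OF summable_geometric[of "1/2 :: real"]]) auto
  have sums: "(\<lambda>N. \<Sum>n<N. (1/2) ^ n *\<^sub>R x n) \<longlonglongrightarrow> v"
    using summable_LIMSEQ[OF summ] by (simp add: v_def)
  have v_ge: "(1/2) ^ n *\<^sub>R x n \<le> v" for n
  proof (rule lattice_LIMSEQ_ge_from[OF sums, of "Suc n"])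
    fix N assume "Suc n \<le> N"
    then show "(1/2) ^ n *\<^sub>R x n \<le> (\<Sum>n<N. (1/2) ^ n *\<^sub>R x n)"
      using sum_mono2[of "{..<N}" "{n}" "\<lambda>n. (1/2) ^ n *\<^sub>R x n"] x(1)
      by (simp add: scaleR_nonneg_nonneg)
  qed
  have v0: "0 \<le> v" using v_ge[of 0] x(1)[of 0] by simp
  define w where "w n = pprt (x n - 4 ^ n *\<^sub>R s n - (1/2) ^ n *\<^sub>R v)" for n
  have w0: "0 \<le> w n" for n by (simp add: w_def)
  have w_le: "w n \<le> x n" for n
  proof -
    have "w n \<le> pprt (x n)"
      unfolding w_def by (intro pprt_mono) (simp add: diff_le_eq s0 v0 scaleR_nonneg_nonneg add_increasing2)
    then show ?thesis using x(1) by simp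
  qed
  have w_disj: "inf (w n) (w m) = 0" if "n < m" for n m
  proof -
    \<comment> \<open>A common witness of disjointness: \<open>w n\<close> is below
      \<open>pprt ?z\<close>, and \<open>w m\<close> is below a multiple of
      \<open>pprt (- ?z)\<close>.\<close>
    let ?z = "x n - (1/4) ^ m *\<^sub>R x m"
    have "(1/4) ^ m *\<^sub>R x m \<le> (1/2) ^ n *\<^sub>R v"
    proof -
      \<comment> \<open>Since \<open>n < m\<close>, scaling by \<open>2^-n\<close> the share
        \<open>2^-m\<close> of \<open>x m\<close> contained in \<open>v\<close> still leaves at
        least \<open>4^-m\<close> of \<open>x m\<close>.\<close>
      have "(1/4::real) ^ m \<le> (1/2) ^ (n + m)"
      proof -
        have "(1/4::real) ^ m = (1/2) ^ (m + m)" by (simp add: power_add flip: power_mult_distrib)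
        also have "\<dots> \<le> (1/2) ^ (n + m)" using that by (intro power_decreasing) auto
        finally show ?thesis .
      qed
      then have "(1/4) ^ m *\<^sub>R x m \<le> (1/2) ^ (n + m) *\<^sub>R x m"
        using x(1) by (intro scaleR_right_mono)
      also have "\<dots> = (1/2) ^ n *\<^sub>R ((1/2) ^ m *\<^sub>R x m)"
        by (simp add: power_add)
      also have "\<dots> \<le> (1/2) ^ n *\<^sub>R v"
        using v_ge by (intro scaleR_left_mono) auto
      finally show ?thesis .
    qed
    moreover have "0 \<le> 4 ^ n *\<^sub>R s n" using s0 by (simp add: scaleR_nonneg_nonneg)
    ultimately have wn: "w n \<le> pprt ?z"
      unfolding w_def by (intro pprt_mono) (simp add: diff_diff_eq diff_left_mono add_increasing)
    have "4 ^ m *\<^sub>R x n \<le> 4 ^ m *\<^sub>R s m"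
      using s_ge[OF that] by (intro scaleR_left_mono) auto
    moreover have "0 \<le> (1/2) ^ m *\<^sub>R v" using v0 by (simp add: scaleR_nonneg_nonneg)
    ultimately have "x m - 4 ^ m *\<^sub>R s m - (1/2) ^ m *\<^sub>R v \<le> x m - 4 ^ m *\<^sub>R x n"
      by (simp add: diff_diff_eq diff_left_mono add_increasing2)
    also have "\<dots> = 4 ^ m *\<^sub>R (- ?z)"
      by (simp add: scaleR_diff_right power_divide)
    also have "\<dots> \<le> 4 ^ m *\<^sub>R pprt (- ?z)"
      by (intro scaleR_left_mono) (auto simp: pprt_def)
    finally have "w m \<le> pprt (4 ^ m *\<^sub>R pprt (- ?z))"
      unfolding w_def by (rule pprt_mono)
    then have wm: "w m \<le> 4 ^ m *\<^sub>R pprt (- ?z)"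
      by (simp add: scaleR_nonneg_nonneg)
    show ?thesis
      by (rule inf_eq_0_mono[OF _ w0 wn w0 wm])
        (intro inf_scaleR_eq_0 inf_pprt_pprt zero_le_pprt, simp)
  qed
  have "(\<lambda>n. blinfun_apply f (w n)) \<longlonglongrightarrow> 0"
  proof (rule disj)
    show "norm (w n) \<le> 1" for n
      using norm_mono_nonneg[OF w0 w_le] x(2) order_trans by blast
    show "inf (w m) (w n) = 0" if "m \<noteq> n" for m n
      using that w_disj[of m n] w_disj[of n m] by (cases "m < n") (auto simp: inf_commute)
  qed (rule w0)
  moreover have "(\<lambda>n. (1/2) ^ n * blinfun_apply f v) \<longlonglongrightarrow> 0"
    by (intro tendsto_mult_left_zero LIMSEQ_realpow_zero) auto
  ultimately have "(\<lambda>n. blinfun_apply f (w n) + (1/2) ^ n * blinfun_apply f v) \<longlonglongrightarrow> 0"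
    using tendsto_add by fastforce
  \<comment> \<open>Adding back the removed multiple of \<open>v\<close>, whose value under
    \<open>f\<close> tends to 0, restores the lower bound \<open>e\<close>.\<close>
  moreover have "e \<le> blinfun_apply f (w n) + (1/2) ^ n * blinfun_apply f v" for n
  proof -
    have "pprt (x n - 4 ^ n *\<^sub>R s n) \<le> w n + (1/2) ^ n *\<^sub>R v"
      unfolding w_def using v0 by (intro pprt_le_add) (simp add: scaleR_nonneg_nonneg)
    then have "blinfun_apply f (pprt (x n - 4 ^ n *\<^sub>R s n)) \<le> blinfun_apply f (w n + (1/2) ^ n *\<^sub>R v)"
      by (rule pos_blinfun_mono[OF f])
    then show ?thesis using x(3)[of n] by (simp add: blinfun.add_right blinfun.scaleR_right)
  qed
  ultimately have "e \<le> 0" by (intro LIMSEQ_le_const) auto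
  then show False using \<open>0 < e\<close> by simp
qed

text \<open>Of two indices beyond \<open>M\<close> with distant values, one is far from
  \<open>X M\<close> itself at the cost of halving the distance. Far neighbours are what the later
  telescoping arguments need.\<close>

lemma not_Cauchy_subseq:
  fixes X :: "nat \<Rightarrow> 'b::metric_space"
  assumes "\<not> Cauchy X"
  obtains e r where "0 < e" "strict_mono r" "\<And>n. e \<le> dist (X (r n)) (X (r (Suc n)))"
proof -
  obtain e where e: "0 < e" "\<And>M. \<exists>m\<ge>M. \<exists>n\<ge>M. e \<le> dist (X m) (X n)"
    using assms unfolding Cauchy_def by (meson not_le)
  have "\<exists>m>M. e / 2 \<le> dist (X M) (X m)" for M
  proof -
    obtain m n where mn: "m \<ge> Suc M" "n \<ge> Suc M" "e \<le> dist (X m) (X n)" using e(2) by blast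
    have "dist (X m) (X n) \<le> dist (X M) (X m) + dist (X M) (X n)"
      by (rule dist_triangle3)
    then have "e / 2 \<le> dist (X M) (X m) \<or> e / 2 \<le> dist (X M) (X n)" using mn(3) by linarith
    then show ?thesis using mn(1,2) by (meson Suc_le_lessD)
  qed
  then obtain r where "\<And>n. r n < r (Suc n) \<and> e / 2 \<le> dist (X (r n)) (X (r (Suc n)))"
    using dependent_nat_choice[of "\<lambda>_ _. True" "\<lambda>_ m m'. m < m' \<and> e / 2 \<le> dist (X m) (X m')"] by metis
  then show thesis
    using that[of "e / 2" r] e(1) by (simp add: strict_mono_Suc_iff)
qed

text \<open>Stated for a general ordered normed space so that it applies both to the lattice and to its
  dual, which is not an instance of \<open>banach_lattice\<close> here.\<close>

lemma directed_decseq_limit: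
  fixes D :: "'b::{real_normed_vector, order} set"
  assumes conv: "\<And>X :: nat \<Rightarrow> 'b. decseq X \<Longrightarrow> (\<And>n. 0 \<le> X n) \<Longrightarrow> convergent X"
    and closed: "\<And>(X :: nat \<Rightarrow> 'b) l b. X \<longlonglongrightarrow> l \<Longrightarrow> (\<And>n. X n \<le> b) \<Longrightarrow> l \<le> b"
    and D: "directed_set D (\<ge>)" "\<And>d. d \<in> D \<Longrightarrow> 0 \<le> d"
  obtains X l where "\<And>n. X n \<in> D" "decseq X" "X \<longlonglongrightarrow> l" "\<And>d. d \<in> D \<Longrightarrow> l \<le> d"
proof -
  \<comment> \<open>Otherwise one can always step down by at least \<open>\<epsilon>\<close>, and
    iterating gives a decreasing sequence in \<open>D\<close> that is not Cauchy.\<close>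
  have small: "\<exists>d\<in>D. \<forall>e\<in>D. e \<le> d \<longrightarrow> dist d e < \<epsilon>" if "0 < \<epsilon>" for \<epsilon>
  proof (rule ccontr)
    assume "\<not> ?thesis"
    then have *: "\<exists>e\<in>D. e \<le> d \<and> \<epsilon> \<le> dist d e" if "d \<in> D" for d using that by (meson not_le)
    obtain d0 where "d0 \<in> D" using D(1) by (auto simp: directed_set_def)
    then obtain X where X: "\<And>n. X n \<in> D" "\<And>n. X (Suc n) \<le> X n \<and> \<epsilon> \<le> dist (X n) (X (Suc n))"
      using dependent_nat_choice[of "\<lambda>_ d. d \<in> D" "\<lambda>_ d e. e \<le> d \<and> \<epsilon> \<le> dist d e"] * by metis
    then have "convergent X" using D(2) by (intro conv) (auto simp: decseq_Suc_iff)
    then have "Cauchy X" by (rule convergent_Cauchy)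
    then obtain M where "\<forall>m\<ge>M. \<forall>n\<ge>M. dist (X m) (X n) < \<epsilon>"
      using \<open>0 < \<epsilon>\<close> unfolding Cauchy_def by blast
    then have "dist (X M) (X (Suc M)) < \<epsilon>" by simp
    then show False using X(2)[of M] by simp
  qed
  have dir: "\<exists>k\<in>D. k \<le> i \<and> k \<le> j" if "i \<in> D" "j \<in> D" for i j
    using D(1) that by (auto simp: directed_set_def)
  \<comment> \<open>Below a good element the whole of \<open>D\<close> stays close, so one
    decreasing sequence of good elements controls the directed set.\<close>
  define good where "good n d \<longleftrightarrow> d \<in> D \<and> (\<forall>e\<in>D. e \<le> d \<longrightarrow> dist d e < inverse (real (Suc n)))" for n d
  have good: "\<exists>k. good n k \<and> k \<le> d" if d: "d \<in> D" for n d
  proof -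
    \<comment> \<open>Half the radius, because distances are recentred from \<open>d'\<close> to
      \<open>k\<close>.\<close>
    obtain d' where d': "d' \<in> D" "\<forall>e\<in>D. e \<le> d' \<longrightarrow> dist d' e < inverse (real (Suc n)) / 2"
      using small[of "inverse (real (Suc n)) / 2"] by auto
    obtain k where k: "k \<in> D" "k \<le> d" "k \<le> d'" using dir[OF d d'(1)] by blast
    have "dist k e < inverse (real (Suc n))" if "e \<in> D" "e \<le> k" for e
    proof -
      have "dist d' e < inverse (real (Suc n)) / 2" "dist d' k < inverse (real (Suc n)) / 2"
        using d'(2) that k order_trans by blast+
      then show ?thesis using dist_triangle3[of k e d'] by (simp add: dist_commute)
    qed
    then show ?thesis using k by (auto simp: good_def)
  qed
  obtain d0 where "d0 \<in> D" using D(1) by (auto simp: directed_set_def)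
  then have "\<exists>d. good 0 d" using good by blast
  moreover have "\<exists>k. good (Suc n) k \<and> k \<le> d" if "good n d" for n d
    using good[of d "Suc n"] that by (auto simp: good_def)
  ultimately obtain X where X: "\<And>n. good n (X n)" "\<And>n. X (Suc n) \<le> X n"
    using dependent_nat_choice[of good "\<lambda>_ d e. e \<le> d"] by metis
  have XD: "X n \<in> D" for n using X(1) by (simp add: good_def)
  have dec: "decseq X" using X(2) by (simp add: decseq_Suc_iff)
  obtain l where l: "X \<longlonglongrightarrow> l"
    using conv[OF dec D(2)[OF XD]] by (auto simp: convergent_def)
  have "l \<le> d" if d: "d \<in> D" for d
  proof -
    \<comment> \<open>\<open>X n\<close> is good, so a common lower element \<open>k n\<close> of
      \<open>X n\<close> and \<open>d\<close> is close to \<open>X n\<close>; hence \<open>k\<close>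
      has the limit \<open>l\<close> while staying below \<open>d\<close>.\<close>
    obtain k where k: "\<And>n. k n \<in> D" "\<And>n. k n \<le> X n" "\<And>n. k n \<le> d"
      using dir[OF XD d] by metis
    have "norm (X n - k n) \<le> inverse (real (Suc n))" for n
      using X(1)[of n] k[of n] unfolding good_def dist_norm by (simp add: less_imp_le)
    then have "(\<lambda>n. X n - k n) \<longlonglongrightarrow> 0"
      by (intro Lim_null_comparison[OF always_eventually LIMSEQ_inverse_real_of_nat] allI)
    from tendsto_diff[OF l this] have "k \<longlonglongrightarrow> l" by simp
    then show "l \<le> d" using k(3) by (rule closed)
  qed
  then show thesis using that XD dec l by blast
qed

text \<open>The limit of the sequence from \<open>directed_decseq_limit\<close> is a nonnegative
  lower bound of \<open>D\<close>, hence 0; monotonicity of the norm carries smallness from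
  \<open>X n\<close> to everything below it.\<close>

lemma order_continuous_normI:
  assumes conv: "\<And>X :: nat \<Rightarrow> 'b::{real_normed_vector, order}. decseq X \<Longrightarrow> (\<And>n. 0 \<le> X n) \<Longrightarrow> convergent X"
    and le: "\<And>(X :: nat \<Rightarrow> 'b) l b. X \<longlonglongrightarrow> l \<Longrightarrow> (\<And>n. X n \<le> b) \<Longrightarrow> l \<le> b"
    and ge: "\<And>(X :: nat \<Rightarrow> 'b) l b. X \<longlonglongrightarrow> l \<Longrightarrow> (\<And>n. b \<le> X n) \<Longrightarrow> b \<le> l"
    and mono: "\<And>x y :: 'b. 0 \<le> x \<Longrightarrow> x \<le> y \<Longrightarrow> norm x \<le> norm y"
  shows "order_continuous_norm TYPE('b)"
  unfolding order_continuous_norm_def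
proof (intro allI impI, elim conjE)
  fix D :: "'b set"
  assume D: "directed_set D (\<ge>)" "\<forall>d\<in>D. 0 \<le> d" "\<forall>b. (\<forall>d\<in>D. b \<le> d) \<longrightarrow> b \<le> 0"
  obtain X l where X: "\<And>n. X n \<in> D" "X \<longlonglongrightarrow> l" "\<And>d. d \<in> D \<Longrightarrow> l \<le> d"
  proof (rule directed_decseq_limit[OF conv le D(1)])
    show "0 \<le> d" if "d \<in> D" for d using D(2) that by blast
  qed blast+
  have "l = 0"
    using D(2,3) X(1,3) ge[OF X(2), of 0] by (intro antisym) auto
  then have lim: "(\<lambda>n. norm (X n)) \<longlonglongrightarrow> 0" using tendsto_norm[OF X(2)] by simp
  show "(norm \<longlongrightarrow> 0) (tails D (\<ge>))"
  proof (rule tendstoI)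
    fix e :: real assume "0 < e"
    then obtain n where "norm (X n) < e"
      using LIMSEQ_D[OF lim] by fastforce
    then have "norm d < e" if "d \<in> D" "d \<le> X n" for d
      using mono[of d "X n"] D(2) that by force
    then show "\<forall>\<^sub>F d in tails D (\<ge>). dist (norm d) 0 < e"
      using X(1)[of n] by (auto simp: eventually_tails[OF D(1)])
  qed
qed

text \<open>Otherwise some subsequence has jumps of norm at least \<open>e\<close>. The jumps are
  positive and telescope below \<open>X (r 0)\<close>, so they are null by hypothesis.\<close>

lemma banach_lattice_decseq_convergent:
  fixes X :: "nat \<Rightarrow> 'a::banach_lattice"
  assumes null: "\<And>(y :: nat \<Rightarrow> 'a) u. (\<And>n. 0 \<le> y n) \<Longrightarrow> (\<And>N. sum y {..<N} \<le> u) \<Longrightarrow> y \<longlonglongrightarrow> 0"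
    and X: "decseq X" "\<And>n. 0 \<le> X n"
  shows "convergent X"
proof (rule ccontr)
  assume "\<not> convergent X"
  then have "\<not> Cauchy X" by (simp add: Cauchy_convergent_iff)
  then obtain e r where e: "0 < e" and r: "strict_mono r"
    and far: "\<And>n. e \<le> dist (X (r n)) (X (r (Suc n)))"
    by (rule not_Cauchy_subseq) blast
  have "(\<lambda>n. X (r n) - X (r (Suc n))) \<longlonglongrightarrow> 0"
  proof (rule null)
    show "0 \<le> X (r n) - X (r (Suc n))" for n
      using X(1) r by (simp add: decseq_def strict_mono_less_eq)
    show "(\<Sum>n<N. X (r n) - X (r (Suc n))) \<le> X (r 0)" for N
      using X(2)[of "r N"] sum_lessThan_telescope'[of "\<lambda>n. X (r n)" N] by simp
  qed
  then obtain n where "dist (X (r n)) (X (r (Suc n))) < e"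
    using LIMSEQ_D[of "\<lambda>n. X (r n) - X (r (Suc n))" 0 e] e by (force simp: dist_norm)
  then show False using far[of n] by simp
qed

text \<open>As \<open>\<bar>h x\<bar> \<le> h \<bar>x\<bar>\<close>, the norm of a positive
  functional is determined on the positive part of the unit ball.\<close>

lemma pos_blinfun_norm_attained:
  fixes h :: "'a::banach_lattice \<Rightarrow>\<^sub>L real"
  assumes "0 \<le> h" "0 < e" "e < norm h"
  obtains x where "0 \<le> x" "norm x \<le> 1" "e < blinfun_apply h x"
proof (rule ccontr)
  assume "\<not> thesis"
  with that have *: "blinfun_apply h x \<le> e" if "0 \<le> x" "norm x \<le> 1" for x
    using \<open>0 \<le> x\<close> \<open>norm x \<le> 1\<close> by (meson not_le)
  have "norm (blinfun_apply h x) \<le> e * norm x" for x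
  proof (cases "x = 0")
    case False
    have "blinfun_apply h (inverse (norm x) *\<^sub>R \<bar>x\<bar>) \<le> e"
      by (rule *) (use False in \<open>auto intro: scaleR_nonneg_nonneg\<close>)
    then have "blinfun_apply h \<bar>x\<bar> \<le> e * norm x"
      using False by (simp add: blinfun.scaleR_right field_simps)
    then show ?thesis using pos_blinfun_abs[OF assms(1), of x] by simp
  qed (simp add: blinfun.zero_right)
  then have "norm h \<le> e" using \<open>0 < e\<close> by (intro norm_blinfun_bound) auto
  then show False using assms(3) by simp
qed

text \<open>All jumps \<open>h n\<close> lie below \<open>X (r 0)\<close>, whose tightness yields a
  single \<open>u\<close> with \<open>h n u \<ge> e / 4\<close> for every \<open>n\<close>; yet the
  numbers \<open>h n u\<close> telescope and tend to 0.\<close>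

lemma dual_decseq_convergent:
  fixes X :: "nat \<Rightarrow> 'a::banach_lattice \<Rightarrow>\<^sub>L real"
  assumes disj: "\<And>(f :: 'a \<Rightarrow>\<^sub>L real) w. 0 \<le> f \<Longrightarrow> (\<And>n. 0 \<le> w n) \<Longrightarrow> (\<And>n. norm (w n) \<le> 1) \<Longrightarrow>
      (\<And>m n. m \<noteq> n \<Longrightarrow> inf (w m) (w n) = 0) \<Longrightarrow> (\<lambda>n. blinfun_apply f (w n)) \<longlonglongrightarrow> 0"
    and X: "decseq X" "\<And>n. 0 \<le> X n"
  shows "convergent X"
proof (rule ccontr)
  assume "\<not> convergent X"
  then have "\<not> Cauchy X" by (simp add: Cauchy_convergent_iff)
  then obtain e r where e: "0 < e" and r: "strict_mono r"
    and far: "\<And>n. e \<le> dist (X (r n)) (X (r (Suc n)))"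
    by (rule not_Cauchy_subseq) blast
  define h where "h n = X (r n) - X (r (Suc n))" for n
  have dec: "blinfun_apply (X n) x \<le> blinfun_apply (X m) x" if "m \<le> n" "0 \<le> x" for m n x
    using decseqD[OF X(1) \<open>m \<le> n\<close>] \<open>0 \<le> x\<close> by (simp add: less_eq_blinfun_def)
  have h0: "0 \<le> h n" for n
    using dec[of "r n" "r (Suc n)"] r
    by (auto simp: h_def pos_blinfun_iff blinfun.diff_left strict_mono_less_eq)
  have h_le: "blinfun_apply (h n) x \<le> blinfun_apply (X (r 0)) x" if "0 \<le> x" for n x
    using dec[of "r 0" "r n" x] X(2)[of "r (Suc n)"] r that
    by (auto simp: h_def blinfun.diff_left strict_mono_less_eq pos_blinfun_iff intro: order_trans add_increasing2)
  obtain u where u: "0 \<le> u"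
    "\<And>x. 0 \<le> x \<Longrightarrow> norm x \<le> 1 \<Longrightarrow> blinfun_apply (X (r 0)) (pprt (x - u)) \<le> e / 4"
    by (rule pos_blinfun_tight[OF X(2) _ disj[OF X(2)], of "e / 4" "r 0"]) (use e in auto)
  have "blinfun_apply (h n) u \<ge> e / 4" for n
  proof -
    have "e / 2 < norm (h n)" using far[of n] e by (simp add: h_def dist_norm)
    then obtain x where x: "0 \<le> x" "norm x \<le> 1" "e / 2 < blinfun_apply (h n) x"
      using pos_blinfun_norm_attained[OF h0, of "e / 2" n] e by auto
    have "blinfun_apply (h n) x = blinfun_apply (h n) (inf x u) + blinfun_apply (h n) (pprt (x - u))"
      by (simp only: inf_add_pprt_diff flip: blinfun.add_right)
    also have "\<dots> \<le> blinfun_apply (h n) u + e / 4"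
      using u(2)[OF x(1,2)] h_le[of "pprt (x - u)" n]
      by (intro add_mono pos_blinfun_mono[OF h0]) auto
    finally show ?thesis using x(3) by simp
  qed
  moreover have "(\<lambda>n. blinfun_apply (h n) u) \<longlonglongrightarrow> 0"
  proof (intro summable_LIMSEQ_zero bounded_imp_summable)
    show "0 \<le> blinfun_apply (h n) u" for n using pos_blinfun_nonneg[OF h0 u(1)] .
    show "(\<Sum>k\<le>n. blinfun_apply (h k) u) \<le> blinfun_apply (X (r 0)) u" for n
      using pos_blinfun_nonneg[OF X(2) u(1), of "r (Suc n)"]
        sum_lessThan_telescope'[of "\<lambda>k. blinfun_apply (X (r k)) u" "Suc n"]
      by (simp only: h_def blinfun.diff_left flip: lessThan_Suc_atMost)
  qed
  ultimately have "e / 4 \<le> 0" by (intro LIMSEQ_le_const) auto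
  then show False using e by simp
qed

lemma dual_norm_mono:
  fixes f g :: "'a::banach_lattice \<Rightarrow>\<^sub>L real"
  assumes "0 \<le> f" "f \<le> g"
  shows "norm f \<le> norm g"
proof (rule norm_blinfun_bound)
  fix x
  have "norm (blinfun_apply f x) \<le> blinfun_apply f \<bar>x\<bar>" using pos_blinfun_abs[OF assms(1)] by simp
  also have "\<dots> \<le> blinfun_apply g \<bar>x\<bar>" using assms(2) by (simp add: less_eq_blinfun_def)
  also have "\<dots> \<le> norm g * norm x" using blinfun_bound[of g "\<bar>x\<bar>"] by simp
  finally show "norm (blinfun_apply f x) \<le> norm g * norm x" .
qed simp

lemma order_continuous_norm_dualI:
  assumes "\<And>(f :: 'a::banach_lattice \<Rightarrow>\<^sub>L real) w. 0 \<le> f \<Longrightarrow> (\<And>n. 0 \<le> w n) \<Longrightarrow> (\<And>n. norm (w n) \<le> 1) \<Longrightarrow>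
      (\<And>m n. m \<noteq> n \<Longrightarrow> inf (w m) (w n) = 0) \<Longrightarrow> (\<lambda>n. blinfun_apply f (w n)) \<longlonglongrightarrow> 0"
  shows "order_continuous_norm TYPE('a \<Rightarrow>\<^sub>L real)"
proof (rule order_continuous_normI)
  show "convergent X" if "decseq X" "\<And>n. 0 \<le> X n" for X :: "nat \<Rightarrow> 'a \<Rightarrow>\<^sub>L real"
    using dual_decseq_convergent[OF assms that] .
  fix X :: "nat \<Rightarrow> 'a \<Rightarrow>\<^sub>L real" and l b
  assume "X \<longlonglongrightarrow> l"
  then have lim: "(\<lambda>n. blinfun_apply (X n) x) \<longlonglongrightarrow> blinfun_apply l x" for x
    by (intro blinfun.tendsto tendsto_const)
  show "l \<le> b" if "\<And>n. X n \<le> b"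
    using that LIMSEQ_le_const2[OF lim] by (simp add: less_eq_blinfun_def)
  show "b \<le> l" if "\<And>n. b \<le> X n"
    using that LIMSEQ_le_const[OF lim] by (simp add: less_eq_blinfun_def)
qed (rule dual_norm_mono)

subsection \<open>Convergence in discrete lattices with order continuous norms\<close>

lemma scaleR_pos: "0 < t \<Longrightarrow> 0 < x \<Longrightarrow> 0 < t *\<^sub>R (x :: 'a::banach_lattice)"
  by (simp add: less_le scaleR_nonneg_nonneg)

section \<open>Atoms and their coordinate functionals\<close>

lemma order_ideal_order_ideal_hull: "order_ideal (order_ideal hull S)"
  by (rule hull_in) (auto simp: order_ideal_def subspace_Inter)

text \<open>The ideal generated by \<open>a\<close> is the explicit set \<open>?J\<close> of
  elements whose modulus is below a multiple of \<open>a\<close>; scaling their positive and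
  negative parts below \<open>a\<close> reduces the span condition to multiples of
  \<open>a\<close>.\<close>

lemma lattice_atom_iff:
  "lattice_atom a \<longleftrightarrow> 0 < a \<and> (\<forall>y. 0 \<le> y \<and> y \<le> a \<longrightarrow> (\<exists>t. y = t *\<^sub>R a))"
proof (intro iffI conjI allI impI; (elim conjE)?)
  assume a: "lattice_atom a"
  then show "0 < a" by (simp add: lattice_atom_def)
  fix y assume y: "0 \<le> y" "y \<le> a"
  have "a \<in> order_ideal hull {a}" by (simp add: hull_inc)
  moreover have "\<bar>y\<bar> \<le> \<bar>a\<bar>" using y by simp
  ultimately have "y \<in> order_ideal hull {a}"
    using order_ideal_order_ideal_hull[of "{a}"] unfolding order_ideal_def by blast
  then show "\<exists>t. y = t *\<^sub>R a"
    using a by (auto simp: lattice_atom_def span_singleton)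
next
  assume a: "0 < a" and *: "\<forall>y. 0 \<le> y \<and> y \<le> a \<longrightarrow> (\<exists>t. y = t *\<^sub>R a)"
  let ?J = "{z. \<exists>c. \<bar>z\<bar> \<le> c *\<^sub>R a}"
  have J_nonneg: "\<exists>c\<ge>0. \<bar>z\<bar> \<le> c *\<^sub>R a" if z: "z \<in> ?J" for z
  proof -
    obtain c where c: "\<bar>z\<bar> \<le> c *\<^sub>R a" using z by auto
    have "c *\<^sub>R a \<le> \<bar>c\<bar> *\<^sub>R a" using a by (intro scaleR_right_mono) auto
    with c show ?thesis by (intro exI[of _ "\<bar>c\<bar>"]) auto
  qed
  have "order_ideal ?J"
    unfolding order_ideal_def
  proof (intro conjI ballI allI impI)
    show "subspace ?J"
    proof (rule subspaceI)
      show "0 \<in> ?J" by (auto intro: exI[of _ 0])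
      show "x + y \<in> ?J" if xy: "x \<in> ?J" "y \<in> ?J" for x y
      proof -
        obtain c d where "\<bar>x\<bar> \<le> c *\<^sub>R a" "\<bar>y\<bar> \<le> d *\<^sub>R a" using xy by auto
        then have "\<bar>x + y\<bar> \<le> (c + d) *\<^sub>R a"
          unfolding scaleR_add_left by (intro order_trans[OF abs_triangle_ineq] add_mono)
        then show ?thesis by blast
      qed
      show "r *\<^sub>R x \<in> ?J" if x: "x \<in> ?J" for r x
      proof -
        obtain c where c: "\<bar>x\<bar> \<le> c *\<^sub>R a" using x by auto
        have "\<bar>r *\<^sub>R x\<bar> \<le> \<bar>r\<bar> *\<^sub>R \<bar>x\<bar>"
        proof (rule abs_leI)
          have "r *\<^sub>R x \<le> \<bar>r\<bar> *\<^sub>R \<bar>x\<bar> \<and> - (r *\<^sub>R x) \<le> \<bar>r\<bar> *\<^sub>R \<bar>x\<bar>"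
          proof (cases "0 \<le> r")
            case True
            then show ?thesis
              using scaleR_left_mono[OF abs_ge_self[of x] True] scaleR_left_mono[OF abs_ge_minus_self[of x] True]
              by simp
          next
            case False
            then have "0 \<le> - r" by simp
            then show ?thesis
              using scaleR_left_mono[OF abs_ge_self[of x] \<open>0 \<le> - r\<close>] scaleR_left_mono[OF abs_ge_minus_self[of x] \<open>0 \<le> - r\<close>] False
              by simp
          qed
          then show "r *\<^sub>R x \<le> \<bar>r\<bar> *\<^sub>R \<bar>x\<bar>" "- (r *\<^sub>R x) \<le> \<bar>r\<bar> *\<^sub>R \<bar>x\<bar>" by auto
        qed
        also have "\<dots> \<le> \<bar>r\<bar> *\<^sub>R (c *\<^sub>R a)" using c by (intro scaleR_left_mono) auto
        finally show ?thesis by auto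
      qed
    qed
    show "y \<in> ?J" if "x \<in> ?J" "\<bar>y\<bar> \<le> \<bar>x\<bar>" for x y
      using that order_trans by blast
  qed
  moreover have "{a} \<subseteq> ?J" using a by (auto intro: exI[of _ 1])
  ultimately have "order_ideal hull {a} \<subseteq> ?J" by (intro hull_minimal)
  moreover have "?J \<subseteq> span {a}"
  proof
    fix z assume "z \<in> ?J"
    then obtain c where c: "0 \<le> c" "\<bar>z\<bar> \<le> c *\<^sub>R a" using J_nonneg by blast
    have span: "y \<in> span {a}" if y: "0 \<le> y" "y \<le> c *\<^sub>R a" for y
    proof (cases "c = 0")
      case True
      then show ?thesis using y span_0 by simp
    next
      case False
      have "inverse c *\<^sub>R y \<le> inverse c *\<^sub>R (c *\<^sub>R a)"
        using c y by (intro scaleR_left_mono) auto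
      moreover have "0 \<le> inverse c *\<^sub>R y" using c y by (intro scaleR_nonneg_nonneg) auto
      ultimately obtain t where "inverse c *\<^sub>R y = t *\<^sub>R a" using * False by auto
      moreover have "y = c *\<^sub>R (inverse c *\<^sub>R y)" using False by simp
      ultimately have "y = (c * t) *\<^sub>R a" by simp
      then show ?thesis unfolding span_singleton by (rule range_eqI)
    qed
    have "pprt z \<le> \<bar>z\<bar>" "pprt (- z) \<le> \<bar>z\<bar>"
      by (simp_all flip: pprt_add_pprt)
    then have "pprt z - pprt (- z) \<in> span {a}"
      using c(2) order_trans by (intro span_diff span zero_le_pprt) blast+
    then show "z \<in> span {a}" by (simp only: pprt_diff_pprt)
  qed
  moreover have "span {a} \<subseteq> order_ideal hull {a}"
    using order_ideal_order_ideal_hull[of "{a}"]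
    by (intro span_minimal hull_subset) (simp add: order_ideal_def)
  ultimately show "lattice_atom a" using a by (auto simp: lattice_atom_def)
qed

text \<open>The admissible coefficients are bounded through the norm, and their supremum is attained
  because the order is closed under norm limits.\<close>

lemma largest_multiple:
  fixes a :: "'a::banach_lattice"
  assumes "0 < a" "0 \<le> x"
  obtains T where "0 \<le> T" "T *\<^sub>R a \<le> x" "\<And>s. s *\<^sub>R a \<le> x \<Longrightarrow> s \<le> T"
proof -
  have a0: "0 \<le> a" "0 < norm a" using assms by auto
  define S where "S = {t. 0 \<le> t \<and> t *\<^sub>R a \<le> x}"
  have bound: "t \<le> norm x / norm a" if "t \<in> S" for t
    using that a0 norm_mono_nonneg[of "t *\<^sub>R a" x]
    by (simp add: S_def scaleR_nonneg_nonneg pos_le_divide_eq)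
  have S: "0 \<in> S" "bdd_above S"
    using assms bound by (auto simp: S_def intro!: bdd_aboveI)
  have "Sup S *\<^sub>R a \<le> x"
  proof (rule lattice_LIMSEQ_le)
    have "(\<lambda>n. (Sup S - inverse (real (Suc n))) *\<^sub>R a) \<longlonglongrightarrow> (Sup S - 0) *\<^sub>R a"
      by (intro tendsto_intros LIMSEQ_inverse_real_of_nat)
    then show "(\<lambda>n. (Sup S - inverse (real (Suc n))) *\<^sub>R a) \<longlonglongrightarrow> Sup S *\<^sub>R a" by simp
    fix n
    obtain s where s: "s \<in> S" "Sup S - inverse (real (Suc n)) < s"
      using less_cSupE[of "Sup S - inverse (real (Suc n))" S] S by auto
    have "(Sup S - inverse (real (Suc n))) *\<^sub>R a \<le> s *\<^sub>R a"
      using s a0 by (intro scaleR_right_mono) auto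
    also have "\<dots> \<le> x" using s by (simp add: S_def)
    finally show "(Sup S - inverse (real (Suc n))) *\<^sub>R a \<le> x" .
  qed
  moreover have "0 \<le> Sup S" using S by (rule cSup_upper)
  moreover have "s \<le> Sup S" if "s *\<^sub>R a \<le> x" for s
  proof (cases "0 \<le> s")
    case True
    then show ?thesis using that S(2) by (intro cSup_upper) (auto simp: S_def)
  next
    case False
    then show ?thesis using \<open>0 \<le> Sup S\<close> by simp
  qed
  ultimately show thesis using that by blast
qed

text \<open>The functional is the coordinate of the band projection onto the line spanned by
  \<open>a\<close>.\<close>

lemma lattice_atom_functional:
  fixes a :: "'a::banach_lattice"
  assumes "lattice_atom a"
  obtains f :: "'a \<Rightarrow>\<^sub>L real" where "0 \<le> f" "\<And>x. 0 \<le> x \<Longrightarrow> blinfun_apply f x *\<^sub>R a \<le> x"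
    "\<And>x. 0 \<le> x \<Longrightarrow> inf a (x - blinfun_apply f x *\<^sub>R a) = 0"
proof -
  have a: "0 < a" and mult: "\<And>y. 0 \<le> y \<Longrightarrow> y \<le> a \<Longrightarrow> \<exists>t. y = t *\<^sub>R a"
    using assms by (auto simp: lattice_atom_iff)
  then have a0: "0 \<le> a" "norm a \<noteq> 0" by auto
  \<comment> \<open>The coefficient is characterised by a remainder disjoint from \<open>a\<close>;
    uniqueness of such a coefficient then yields additivity.\<close>
  define coord where "coord x t \<longleftrightarrow> 0 \<le> t \<and> t *\<^sub>R a \<le> x \<and> inf a (x - t *\<^sub>R a) = 0" for x t
  have bound: "t \<le> inverse (norm a) * norm x" if "0 \<le> t" "t *\<^sub>R a \<le> x" for t x
  proof -
    have "t * norm a \<le> norm x"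
      using norm_mono_nonneg[OF scaleR_nonneg_nonneg[OF that(1) a0(1)] that(2)] that(1) by simp
    then show ?thesis using a0(2) by (simp add: field_simps)
  qed
  have ex: "\<exists>t. coord x t" if x: "0 \<le> x" for x
  proof -
    obtain T where T: "0 \<le> T" "T *\<^sub>R a \<le> x" "\<And>s. s *\<^sub>R a \<le> x \<Longrightarrow> s \<le> T"
      using largest_multiple[OF a x] by blast
    let ?y = "inf a (x - T *\<^sub>R a)"
    have y: "0 \<le> ?y" using a0 T(2) by simp
    \<comment> \<open>Atomicity makes the overlap a multiple of \<open>a\<close>, and a positive
      \<open>s\<close> would contradict the maximality of \<open>T\<close>.\<close>
    then obtain s where s: "?y = s *\<^sub>R a" using mult[of ?y] by auto
    have "s *\<^sub>R a \<le> x - T *\<^sub>R a" unfolding s[symmetric] by simp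
    then have "(T + s) *\<^sub>R a \<le> x" by (simp add: scaleR_add_left le_diff_eq add.commute)
    then have "s \<le> 0" using T(3) by force
    then have "?y \<le> 0" using s a0 by (simp add: scaleR_nonpos_nonneg)
    then have "?y = 0" using y by (rule antisym)
    then show ?thesis using T by (auto simp: coord_def)
  qed
  have le: "s \<le> t" if st: "coord x s" "coord x t" for x s t
  proof (rule ccontr)
    assume "\<not> s \<le> t"
    \<comment> \<open>The cap 1 puts \<open>r *\<^sub>R a\<close> below \<open>a\<close> as well as
      below the remainder of \<open>x\<close>.\<close>
    define r where "r = min 1 (s - t)"
    have r: "0 < r" "r \<le> 1" "r \<le> s - t" using \<open>\<not> s \<le> t\<close> by (auto simp: r_def)
    have "r *\<^sub>R a \<le> 1 *\<^sub>R a" using r a0 by (intro scaleR_right_mono)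
    moreover have "r *\<^sub>R a \<le> (s - t) *\<^sub>R a" using r a0 by (intro scaleR_right_mono)
    then have "r *\<^sub>R a \<le> s *\<^sub>R a - t *\<^sub>R a" by (simp only: scaleR_diff_left)
    then have "r *\<^sub>R a \<le> x - t *\<^sub>R a"
      using st by (auto simp: coord_def intro: order_trans diff_right_mono)
    ultimately have "r *\<^sub>R a \<le> inf a (x - t *\<^sub>R a)" by (intro le_infI) simp_all
    then have "r *\<^sub>R a \<le> 0" using st(2) unfolding coord_def by metis
    moreover have "0 < r *\<^sub>R a" using r a by (intro scaleR_pos)
    ultimately show False by simp
  qed
  have uniq: "s = t" if "coord x s" "coord x t" for x s t
    using le that by (blast intro: antisym)
  define \<phi> where "\<phi> x = (SOME t. coord x t)" for x
  have \<phi>: "coord x (\<phi> x)" if "0 \<le> x" for x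
    unfolding \<phi>_def using ex[OF that] by (rule someI_ex)
  obtain f where f: "\<And>x. 0 \<le> x \<Longrightarrow> blinfun_apply f x = \<phi> x"
  proof (rule positive_extension[of \<phi> "inverse (norm a)"])
    fix x y :: 'a
    assume xy: "0 \<le> x" "0 \<le> y"
    note c = \<phi>[OF xy(1)] \<phi>[OF xy(2)]
    have eq: "x + y - (\<phi> x + \<phi> y) *\<^sub>R a = (x - \<phi> x *\<^sub>R a) + (y - \<phi> y *\<^sub>R a)"
      by (simp add: scaleR_add_left)
    have nn: "0 \<le> x - \<phi> x *\<^sub>R a" "0 \<le> y - \<phi> y *\<^sub>R a"
      using c by (simp_all add: coord_def)
    have "inf a (x + y - (\<phi> x + \<phi> y) *\<^sub>R a) \<le> 0"
      using inf_add_le[OF a0(1) nn] c unfolding eq by (simp add: coord_def)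
    moreover have "0 \<le> inf a (x + y - (\<phi> x + \<phi> y) *\<^sub>R a)"
      using a0 nn unfolding eq by (intro le_infI add_nonneg_nonneg)
    moreover have "(\<phi> x + \<phi> y) *\<^sub>R a \<le> x + y"
      using c by (simp add: coord_def scaleR_add_left add_mono)
    ultimately have "coord (x + y) (\<phi> x + \<phi> y)"
      using c by (auto simp: coord_def intro: antisym)
    then show "\<phi> (x + y) = \<phi> x + \<phi> y"
      using uniq \<phi>[of "x + y"] xy by (simp add: add_nonneg_nonneg)
  next
    fix x :: 'a assume "0 \<le> x"
    then have "coord x (\<phi> x)" by (rule \<phi>)
    then show "0 \<le> \<phi> x" "\<phi> x \<le> inverse (norm a) * norm x"
      using bound by (auto simp: coord_def)
  qed blast
  show thesis
  proof
    show "0 \<le> f" using f \<phi> by (simp add: pos_blinfun_iff coord_def)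
  qed (use f \<phi> in \<open>simp_all add: coord_def\<close>)
qed

lemma norm_null_comparison:
  assumes "\<And>i. norm (y i) \<le> g i" and "(g \<longlongrightarrow> 0) F"
  shows "((\<lambda>i. norm (y i)) \<longlongrightarrow> 0) F"
  by (rule Lim_null_comparison[OF always_eventually assms(2)]) (simp add: assms(1))

text \<open>The coordinate functional commutes with the modulus, so it tends to 0 along
  \<open>\<bar>x i\<bar>\<close>; the truncation at \<open>a\<close> sees only this coordinate, the
  remainder being disjoint from \<open>a\<close>.\<close>

lemma weak_null_inf_atom:
  fixes x :: "'i \<Rightarrow> 'a::banach_lattice"
  assumes a: "lattice_atom a" and x: "weak_tendsto x 0 F"
  shows "((\<lambda>i. norm (inf \<bar>x i\<bar> a)) \<longlongrightarrow> 0) F"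
proof -
  obtain f :: "'a \<Rightarrow>\<^sub>L real" where f: "0 \<le> f" "\<And>x. 0 \<le> x \<Longrightarrow> blinfun_apply f x *\<^sub>R a \<le> x"
    "\<And>x. 0 \<le> x \<Longrightarrow> inf a (x - blinfun_apply f x *\<^sub>R a) = 0"
    using lattice_atom_functional[OF a] by metis
  have a0: "0 < a" using a by (simp add: lattice_atom_def)
  have f_abs: "blinfun_apply f \<bar>y\<bar> = \<bar>blinfun_apply f y\<bar>" for y
  proof -
    let ?p = "blinfun_apply f (pprt y)" and ?n = "blinfun_apply f (pprt (- y))"
    have pn: "0 \<le> ?p" "0 \<le> ?n" using f(1) by (simp_all add: pos_blinfun_nonneg)
    \<comment> \<open>This multiple of \<open>a\<close> lies below two disjoint elements, so the
      smaller coordinate is 0.\<close>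
    have "min ?p ?n *\<^sub>R a \<le> ?p *\<^sub>R a" "min ?p ?n *\<^sub>R a \<le> ?n *\<^sub>R a"
      using a0 by (auto intro!: scaleR_right_mono)
    then have "min ?p ?n *\<^sub>R a \<le> inf (pprt y) (pprt (- y))"
      using f(2)[of "pprt y"] f(2)[of "pprt (- y)"] by (auto intro: order_trans)
    then have "min ?p ?n *\<^sub>R a \<le> 0" by (simp add: inf_pprt_pprt)
    then have "\<not> 0 < min ?p ?n"
      using scaleR_pos[OF _ a0] leD by blast
    then have "\<bar>?p - ?n\<bar> = ?p + ?n" using pn by linarith
    then show ?thesis
      by (simp only: pprt_diff_pprt pprt_add_pprt flip: blinfun.diff_right blinfun.add_right)
  qed
  have "norm (inf \<bar>x i\<bar> a) \<le> \<bar>blinfun_apply f (x i)\<bar> * norm a" for i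
  proof -
    let ?t = "blinfun_apply f \<bar>x i\<bar>"
    have t: "0 \<le> ?t" using f(1) by (simp add: pos_blinfun_nonneg)
    have "inf a (?t *\<^sub>R a + (\<bar>x i\<bar> - ?t *\<^sub>R a)) \<le> inf a (?t *\<^sub>R a) + inf a (\<bar>x i\<bar> - ?t *\<^sub>R a)"
      using a0 t f(2)[of "\<bar>x i\<bar>"] by (intro inf_add_le) (auto intro: scaleR_nonneg_nonneg)
    then have "inf \<bar>x i\<bar> a \<le> ?t *\<^sub>R a"
      using f(3)[of "\<bar>x i\<bar>"] by (simp add: inf_commute)
    then have "norm (inf \<bar>x i\<bar> a) \<le> norm (?t *\<^sub>R a)"
      using a0 by (intro norm_mono_nonneg) auto
    then show ?thesis by (simp add: f_abs)
  qed
  moreover have "((\<lambda>i. \<bar>blinfun_apply f (x i)\<bar> * norm a) \<longlongrightarrow> 0) F"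
    using x[unfolded weak_tendsto_def, rule_format, of f]
    by (intro tendsto_mult_left_zero tendsto_rabs_zero) (simp add: blinfun.zero_right)
  ultimately show ?thesis by (rule norm_null_comparison)
qed

text \<open>The set \<open>N\<close> contains the atoms and is closed under addition. A lower bound
  of the remainders \<open>pprt (u - s)\<close> that is not below 0 would give an atom all of whose
  multiples stay below \<open>u\<close>. So order continuity makes some remainder small in
  norm.\<close>

lemma un_null_of_atoms:
  fixes x :: "'i \<Rightarrow> 'a::banach_lattice"
  assumes discrete: "discrete_lattice TYPE('a)" and oc: "order_continuous_norm TYPE('a)"
    and atoms: "\<And>a. lattice_atom a \<Longrightarrow> ((\<lambda>i. norm (inf \<bar>x i\<bar> a)) \<longlongrightarrow> 0) F"
  shows "un_tendsto x 0 F"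
  unfolding un_tendsto_def
proof (intro allI impI)
  fix u :: 'a assume u: "0 \<le> u"
  define N where "N = {s. 0 \<le> s \<and> ((\<lambda>i. norm (inf \<bar>x i\<bar> s)) \<longlongrightarrow> 0) F}"
  have inf0: "inf \<bar>x i\<bar> 0 = 0" for i by (simp add: inf_absorb2)
  have N0: "0 \<in> N" by (simp add: N_def inf0)
  have N_add: "s + t \<in> N" if "s \<in> N" "t \<in> N" for s t
  proof -
    have st: "0 \<le> s" "0 \<le> t" using that by (auto simp: N_def)
    have "norm (inf \<bar>x i\<bar> (s + t)) \<le> norm (inf \<bar>x i\<bar> s) + norm (inf \<bar>x i\<bar> t)" for i
      using st by (intro order_trans[OF norm_mono_nonneg[OF _ inf_add_le] norm_triangle_ineq]) auto
    moreover have "((\<lambda>i. norm (inf \<bar>x i\<bar> s) + norm (inf \<bar>x i\<bar> t)) \<longlongrightarrow> 0) F"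
      using that by (intro tendsto_add_zero) (auto simp: N_def)
    ultimately have "((\<lambda>i. norm (inf \<bar>x i\<bar> (s + t))) \<longlongrightarrow> 0) F"
      by (rule norm_null_comparison)
    then show ?thesis using st by (simp add: N_def)
  qed
  define D where "D = (\<lambda>s. pprt (u - s)) ` N"
  have D: "directed_set D (\<ge>)"
    unfolding directed_set_def
  proof (intro conjI ballI)
    fix d e assume "d \<in> D" "e \<in> D"
    then obtain s t where st: "s \<in> N" "t \<in> N" "d = pprt (u - s)" "e = pprt (u - t)"
      by (auto simp: D_def)
    then have "0 \<le> s" "0 \<le> t" by (auto simp: N_def)
    then have "pprt (u - (s + t)) \<le> d" "pprt (u - (s + t)) \<le> e"
      unfolding st(3,4) by (auto intro!: pprt_mono diff_left_mono)
    then show "\<exists>k\<in>D. k \<le> d \<and> k \<le> e"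
      using N_add[OF st(1,2)] by (auto simp: D_def)
  qed (use N0 in \<open>auto simp: D_def reflp_on_def transp_on_def\<close>)
  have "b \<le> 0" if b: "\<forall>d\<in>D. b \<le> d" for b
  proof (rule ccontr)
    assume "\<not> b \<le> 0"
    then have "0 < pprt b" by (simp add: le_zero_iff_zero_pprt less_le)
    then obtain a where a: "lattice_atom a" "a \<le> pprt b"
      using discrete by (auto simp: discrete_lattice_def)
    have a0: "0 < a" using a by (simp add: lattice_atom_def)
    have "a \<in> N" using a0 atoms[OF a(1)] by (simp add: N_def)
    \<comment> \<open>After removing \<open>n\<close> copies of \<open>a\<close> from
      \<open>u\<close>, the lower bound leaves room for one more.\<close>
    have n: "real n *\<^sub>R a \<in> N \<and> real n *\<^sub>R a \<le> u" for n
    proof (induction n)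
      case (Suc n)
      then have "b \<le> pprt (u - real n *\<^sub>R a)" using b by (auto simp: D_def)
      then have "pprt b \<le> pprt (u - real n *\<^sub>R a)" by (simp add: pprt_def)
      then have "a \<le> u - real n *\<^sub>R a" using a(2) Suc by simp
      then show ?case using N_add[OF \<open>a \<in> N\<close>] Suc
        by (simp add: scaleR_add_left le_diff_eq)
    qed (use N0 u in simp)
    have "real n * norm a \<le> norm u" for n
      using n[of n] norm_mono_nonneg[of "real n *\<^sub>R a" u] a0 by (simp add: scaleR_nonneg_nonneg)
    moreover have "0 < norm a" using a0 by simp
    then obtain n where "norm u < real n * norm a" using reals_Archimedean3 by blast
    ultimately show False by (meson not_le)
  qed
  then have "(norm \<longlongrightarrow> 0) (tails D (\<ge>))"
    using oc D unfolding order_continuous_norm_def by (auto simp: D_def)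
  then have small: "\<exists>d\<in>D. norm d < e" if "0 < e" for e
    using that D tendstoD[of norm 0 "tails D (\<ge>)" e] by (auto simp: eventually_tails)
  show "((\<lambda>i. norm (inf \<bar>x i - 0\<bar> u)) \<longlongrightarrow> 0) F"
  proof (rule tendstoI)
    fix e :: real assume "0 < e"
    then obtain s where s: "s \<in> N" "norm (pprt (u - s)) < e / 2"
      using small[of "e / 2"] by (auto simp: D_def)
    have s0: "0 \<le> s" using s(1) by (simp add: N_def)
    have "\<forall>\<^sub>F i in F. norm (inf \<bar>x i\<bar> s) < e / 2"
      using s(1) \<open>0 < e\<close> tendstoD[of "\<lambda>i. norm (inf \<bar>x i\<bar> s)" 0 F "e / 2"] by (simp add: N_def)
    then show "\<forall>\<^sub>F i in F. dist (norm (inf \<bar>x i - 0\<bar> u)) 0 < e"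
    proof (rule eventually_mono)
      fix i assume i: "norm (inf \<bar>x i\<bar> s) < e / 2"
      have "inf \<bar>x i\<bar> (inf u s + pprt (u - s)) \<le> inf \<bar>x i\<bar> (inf u s) + inf \<bar>x i\<bar> (pprt (u - s))"
        using u s0 by (intro inf_add_le) auto
      also have "\<dots> \<le> inf \<bar>x i\<bar> s + pprt (u - s)"
        by (intro add_mono inf_mono) auto
      finally have "inf \<bar>x i\<bar> u \<le> inf \<bar>x i\<bar> s + pprt (u - s)" by (simp only: inf_add_pprt_diff)
      then have "norm (inf \<bar>x i\<bar> u) \<le> norm (inf \<bar>x i\<bar> s) + norm (pprt (u - s))"
        using u by (intro order_trans[OF norm_mono_nonneg norm_triangle_ineq]) auto
      then show "dist (norm (inf \<bar>x i - 0\<bar> u)) 0 < e" using i s(2) by simp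
    qed
  qed
qed

section \<open>Relations among the three modes of convergence\<close>

lemma weak_null_un_null:
  fixes x :: "'i \<Rightarrow> 'a::banach_lattice"
  assumes "discrete_lattice TYPE('a)" "order_continuous_norm TYPE('a)" "weak_tendsto x 0 F"
  shows "un_tendsto x 0 F"
  using assms by (intro un_null_of_atoms weak_null_inf_atom)

text \<open>The truncated family is weakly null, hence un-null; truncating it at \<open>u\<close>
  once more changes nothing.\<close>

lemma uaw_null_un_null:
  fixes x :: "'i \<Rightarrow> 'a::banach_lattice"
  assumes "discrete_lattice TYPE('a)" "order_continuous_norm TYPE('a)" "uaw_tendsto x 0 F"
  shows "un_tendsto x 0 F"
  unfolding un_tendsto_def
proof (intro allI impI)
  fix u :: 'a assume u: "0 \<le> u"
  then have "un_tendsto (\<lambda>i. inf \<bar>x i - 0\<bar> u) 0 F"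
    using assms(3) by (intro weak_null_un_null[OF assms(1,2)]) (auto simp: uaw_tendsto_def)
  from this[unfolded un_tendsto_def, rule_format, OF u]
  show "((\<lambda>i. norm (inf \<bar>x i - 0\<bar> u)) \<longlongrightarrow> 0) F"
    using u by simp
qed

lemma un_null_uaw_null:
  fixes x :: "'i \<Rightarrow> 'a::banach_lattice"
  assumes "un_tendsto x 0 F"
  shows "uaw_tendsto x 0 F"
  unfolding uaw_tendsto_def weak_tendsto_def
proof (intro allI impI)
  fix u :: 'a and f :: "'a \<Rightarrow>\<^sub>L real"
  assume u: "0 \<le> u"
  have "((\<lambda>i. inf \<bar>x i - 0\<bar> u) \<longlongrightarrow> 0) F"
    by (rule tendsto_norm_zero_cancel) (rule assms[unfolded un_tendsto_def, rule_format, OF u])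
  then show "((\<lambda>i. blinfun_apply f (inf \<bar>x i - 0\<bar> u)) \<longlongrightarrow> blinfun_apply f 0) F"
    by (intro blinfun.tendsto tendsto_const)
qed

text \<open>\<open>\<phi> n\<close> is the part of \<open>f\<close> carried by the band of \<open>w n\<close>. These parts are disjoint and their sum is
  at most \<open>f\<close>, so their tails \<open>G m\<close> decrease to \<open>0\<close> in the dual, while
  \<open>f (w n) \<le> G n (w n) \<le> \<parallel>G n\<parallel>\<close>.\<close>

lemma disjoint_null_of_dual_order_continuous:
  fixes f :: "'a::banach_lattice \<Rightarrow>\<^sub>L real" and w :: "nat \<Rightarrow> 'a"
  assumes oc: "order_continuous_norm TYPE('a \<Rightarrow>\<^sub>L real)" and f: "0 \<le> f"
    and w: "\<And>n. 0 \<le> w n" "\<And>n. norm (w n) \<le> 1" "\<And>m n. m \<noteq> n \<Longrightarrow> inf (w m) (w n) = 0"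
  shows "(\<lambda>n. blinfun_apply f (w n)) \<longlonglongrightarrow> 0"
proof -
  \<comment> \<open>Truncating \<open>x\<close> at growing multiples of \<open>w n\<close>
    approximates its band projection; the limit of the \<open>f\<close>-values exists even when that
    projection does not.\<close>
  define a where "a n x k = blinfun_apply f (inf x (real k *\<^sub>R w n))" for n x k
  define \<phi> where "\<phi> n x = (SUP k. a n x k)" for n x
  have a_le: "a n x k \<le> blinfun_apply f x" for n x k
    unfolding a_def by (intro pos_blinfun_mono[OF f]) simp
  have kw: "0 \<le> real k *\<^sub>R w n" for k n using w(1) by (simp add: scaleR_nonneg_nonneg)
  have a_inc: "incseq (a n x)" for n x
    unfolding a_def incseq_def
    by (intro allI impI pos_blinfun_mono[OF f] inf_mono order_refl scaleR_right_mono w(1)) simp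
  have bdd: "bdd_above (range (a n x))" for n x
    using a_le by (intro bdd_aboveI2)
  have a_lim: "a n x \<longlonglongrightarrow> \<phi> n x" for n x
    unfolding \<phi>_def by (rule LIMSEQ_incseq_SUP[OF bdd a_inc])
  have a_\<phi>: "a n x k \<le> \<phi> n x" for n x k
    unfolding \<phi>_def by (rule cSUP_upper[OF _ bdd]) simp
  have \<phi>0: "0 \<le> \<phi> n x" if "0 \<le> x" for n x
    using a_\<phi>[of n x 0] that by (simp add: a_def inf_absorb2)
  have \<phi>_add: "\<phi> n (x + y) = \<phi> n x + \<phi> n y" if xy: "0 \<le> x" "0 \<le> y" for n x y
  proof (rule antisym)
    show "\<phi> n (x + y) \<le> \<phi> n x + \<phi> n y"
    proof (rule LIMSEQ_le_const2[OF a_lim], intro exI allI impI)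
      fix k
      have "inf (x + y) (real k *\<^sub>R w n) \<le> inf x (real k *\<^sub>R w n) + inf y (real k *\<^sub>R w n)"
        using inf_add_le[OF kw xy] by (simp add: inf_commute)
      then have "a n (x + y) k \<le> a n x k + a n y k"
        unfolding a_def by (simp only: pos_blinfun_mono[OF f] flip: blinfun.add_right)
      then show "a n (x + y) k \<le> \<phi> n x + \<phi> n y" using a_\<phi>[of n x k] a_\<phi>[of n y k] by simp
    qed
    show "\<phi> n x + \<phi> n y \<le> \<phi> n (x + y)"
    proof (rule LIMSEQ_le_const2[OF tendsto_add[OF a_lim a_lim]], intro exI allI impI)
      fix k
      \<comment> \<open>Two cuts at the multiple \<open>k\<close> add up to an element below the cut
        at \<open>k + k\<close>, which has the same limit.\<close>
      have "inf x (real k *\<^sub>R w n) + inf y (real k *\<^sub>R w n) \<le> inf (x + y) (real (k + k) *\<^sub>R w n)"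
        unfolding of_nat_add scaleR_add_left by (intro le_infI add_mono) auto
      then have "a n x k + a n y k \<le> a n (x + y) (k + k)"
        unfolding a_def by (simp only: pos_blinfun_mono[OF f] flip: blinfun.add_right)
      then show "a n x k + a n y k \<le> \<phi> n (x + y)" using a_\<phi>[of n "x + y" "k + k"] by simp
    qed
  qed
  have \<phi>_sum: "(\<Sum>n<N. \<phi> (n + m) x) \<le> blinfun_apply f x" if x: "0 \<le> x" for N m x
  proof (rule LIMSEQ_le_const2[OF tendsto_sum[OF a_lim]], intro exI allI impI)
    fix k
    \<comment> \<open>For fixed \<open>k\<close> the cuts are disjoint elements below
      \<open>x\<close>, so their sum stays below \<open>x\<close>.\<close>
    have "(\<Sum>n<N. inf x (real k *\<^sub>R w (n + m))) \<le> x"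
    proof (rule sum_disjoint_le)
      fix i j :: nat assume "i \<noteq> j"
      then have "inf (real k *\<^sub>R w (i + m)) (real k *\<^sub>R w (j + m)) = 0"
        using inf_scaleR_eq_0[OF kw w(1), of k "i + m" "j + m" "real k"]
          inf_scaleR_eq_0[OF w(1) w(1) w(3), of "j + m" "i + m" "real k"]
        by (simp add: inf_commute)
      then show "inf (inf x (real k *\<^sub>R w (i + m))) (inf x (real k *\<^sub>R w (j + m))) = 0"
        by (rule inf_eq_0_mono) (use x kw in auto)
    qed (use x kw in auto)
    then show "(\<Sum>n<N. a (n + m) x k) \<le> blinfun_apply f x"
      unfolding a_def by (simp only: pos_blinfun_mono[OF f] flip: blinfun.sum_right)
  qed
  have summ: "summable (\<lambda>n. \<phi> (n + m) x)" if "0 \<le> x" for m x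
    using \<phi>_sum[OF that, of _ "Suc _"] \<phi>0[OF that] \<phi>_sum[OF that, of m]
    by (intro summableI_nonneg_bounded) auto
  define \<gamma> where "\<gamma> m x = (\<Sum>n. \<phi> (n + m) x)" for m x
  have "\<exists>G :: 'a \<Rightarrow>\<^sub>L real. \<forall>x\<ge>0. blinfun_apply G x = \<gamma> m x" for m
  proof -
    obtain G where "\<And>x. 0 \<le> x \<Longrightarrow> blinfun_apply G x = \<gamma> m x"
    proof (rule positive_extension[of "\<gamma> m" "norm f"])
      show "\<gamma> m (x + y) = \<gamma> m x + \<gamma> m y" if "0 \<le> x" "0 \<le> y" for x y
        using suminf_add[OF summ[OF that(1)] summ[OF that(2)]] that by (simp add: \<gamma>_def \<phi>_add)
      fix x :: 'a assume x: "0 \<le> x"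
      show "0 \<le> \<gamma> m x" unfolding \<gamma>_def using summ[OF x] \<phi>0[OF x] by (rule suminf_nonneg)
      have "\<gamma> m x \<le> blinfun_apply f x"
        unfolding \<gamma>_def using summ[OF x] \<phi>_sum[OF x] by (rule suminf_le_const)
      then show "\<gamma> m x \<le> norm f * norm x" using blinfun_bound[of f x] by simp
    qed blast
    then show ?thesis by blast
  qed
  then obtain G :: "nat \<Rightarrow> 'a \<Rightarrow>\<^sub>L real" where G: "\<And>m x. 0 \<le> x \<Longrightarrow> blinfun_apply (G m) x = \<gamma> m x"
    by metis
  have \<gamma>_Suc: "\<gamma> m x = \<phi> m x + \<gamma> (Suc m) x" if "0 \<le> x" for m x
    using suminf_split_head[OF summ[OF that, of m]] by (simp add: \<gamma>_def)
  have "G (Suc n) \<le> G n" for n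
    unfolding less_eq_blinfun_def
  proof (intro allI impI)
    fix x assume "0 \<le> (x :: 'a)"
    then show "blinfun_apply (G (Suc n)) x \<le> blinfun_apply (G n) x"
      using G[of x n] G[of x "Suc n"] \<gamma>_Suc[of x n] \<phi>0[of x n] by linarith
  qed
  then have G_dec: "decseq G" by (simp add: decseq_Suc_iff)
  have \<gamma>_lim: "(\<lambda>m. \<gamma> m x) \<longlonglongrightarrow> 0" if "0 \<le> x" for x
  proof -
    have s: "summable (\<lambda>n. \<phi> n x)" using summ[OF that, of 0] by simp
    have "\<gamma> m x = (\<Sum>n. \<phi> n x) - (\<Sum>n<m. \<phi> n x)" for m
      unfolding \<gamma>_def by (rule suminf_minus_initial_segment[OF s])
    then show ?thesis
      using tendsto_diff[OF tendsto_const summable_LIMSEQ[OF s], of "\<Sum>n. \<phi> n x"] by simp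
  qed
  have \<gamma>0: "0 \<le> \<gamma> m x" if "0 \<le> x" for m x
    unfolding \<gamma>_def using summ[OF that] \<phi>0[OF that] by (rule suminf_nonneg)
  have D: "directed_set (range G) (\<ge>)"
    unfolding directed_set_def
  proof (intro conjI ballI)
    fix i j assume "i \<in> range G" "j \<in> range G"
    then obtain m n where "i = G m" "j = G n" by auto
    then show "\<exists>k\<in>range G. k \<le> i \<and> k \<le> j"
      using decseqD[OF G_dec, of m "max m n"] decseqD[OF G_dec, of n "max m n"] by auto
  qed (auto simp: reflp_on_def transp_on_def)
  have lower: "b \<le> 0" if "\<forall>d\<in>range G. b \<le> d" for b
    unfolding less_eq_blinfun_def
  proof (intro allI impI)
    fix x :: 'a assume x: "0 \<le> x"
    have "blinfun_apply b x \<le> \<gamma> m x" for m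
      using that x G by (auto simp: less_eq_blinfun_def)
    then show "blinfun_apply b x \<le> blinfun_apply 0 x"
      using LIMSEQ_le_const[OF \<gamma>_lim[OF x]] by simp
  qed
  have "\<forall>d\<in>range G. 0 \<le> d" using G \<gamma>0 by (auto simp: pos_blinfun_iff)
  then have lim: "(norm \<longlongrightarrow> 0) (tails (range G) (\<ge>))"
    using oc D lower unfolding order_continuous_norm_def by blast
  show ?thesis
  proof (rule LIMSEQ_I)
    fix e :: real assume "0 < e"
    then obtain N where N: "\<forall>d\<in>range G. d \<le> G N \<longrightarrow> norm d < e"
      using tendstoD[OF lim, of e] unfolding eventually_tails[OF D] by auto
    have "norm (blinfun_apply f (w n) - 0) < e" if "N \<le> n" for n
    proof -
      \<comment> \<open>The cut at multiple 1 leaves \<open>w n\<close> unchanged.\<close>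
      have "blinfun_apply f (w n) = a n (w n) 1" by (simp add: a_def)
      also have "\<dots> \<le> blinfun_apply (G n) (w n)"
        using a_\<phi>[of n "w n" 1] G[OF w(1), of n n] \<gamma>_Suc[OF w(1), of n n] \<gamma>0[OF w(1), of "Suc n" n] by linarith
      also have "\<dots> \<le> norm (G n) * norm (w n)" by (rule blinfun_bound)
      also have "\<dots> \<le> norm (G n)" using w(2)[of n] by (simp add: mult_left_le)
      also have "\<dots> < e" using decseqD[OF G_dec that] N by blast
      finally show ?thesis using pos_blinfun_nonneg[OF f w(1)[of n]] by simp
    qed
    then show "\<exists>N. \<forall>n\<ge>N. norm (blinfun_apply f (w n) - 0) < e" by blast
  qed
qed

text \<open>After scaling into the unit ball, the excess over \<open>u\<close> is uniformly small
  under \<open>g\<close> by tightness, and the truncation at \<open>u\<close> is handled by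
  un-convergence.\<close>

lemma un_null_weak_null:
  fixes x :: "'i \<Rightarrow> 'a::banach_lattice"
  assumes oc: "order_continuous_norm TYPE('a \<Rightarrow>\<^sub>L real)"
    and x: "un_tendsto x 0 F" and bounded: "\<forall>\<^sub>F i in F. norm (x i) \<le> B"
  shows "weak_tendsto x 0 F"
proof (rule weak_null_majorant)
  fix g :: "'a \<Rightarrow>\<^sub>L real" assume g: "0 \<le> g"
  define C where "C = max B 1"
  have C: "0 < C" "B \<le> C" by (auto simp: C_def)
  show "((\<lambda>i. blinfun_apply g \<bar>x i\<bar>) \<longlongrightarrow> 0) F"
  proof (rule tendstoI)
    fix e :: real assume "0 < e"
    then have e: "0 < e / (2 * C)" using C by simp
    obtain u where u: "0 \<le> u"
      "\<And>z. 0 \<le> z \<Longrightarrow> norm z \<le> 1 \<Longrightarrow> blinfun_apply g (pprt (z - u)) \<le> e / (2 * C)"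
      using pos_blinfun_tight[OF g e disjoint_null_of_dual_order_continuous[OF oc g]] by metis
    have "0 \<le> C *\<^sub>R u" using C u(1) by (simp add: scaleR_nonneg_nonneg)
    from x[unfolded un_tendsto_def diff_zero, rule_format, OF this]
    have "((\<lambda>i. inf \<bar>x i\<bar> (C *\<^sub>R u)) \<longlongrightarrow> 0) F"
      by (rule tendsto_norm_zero_cancel)
    then have "((\<lambda>i. blinfun_apply g (inf \<bar>x i\<bar> (C *\<^sub>R u))) \<longlongrightarrow> blinfun_apply g 0) F"
      by (intro blinfun.tendsto tendsto_const)
    then have "\<forall>\<^sub>F i in F. \<bar>blinfun_apply g (inf \<bar>x i\<bar> (C *\<^sub>R u))\<bar> < e / 2"
      using \<open>0 < e\<close> tendstoD[of _ "blinfun_apply g 0" F "e / 2"] by (simp add: blinfun.zero_right)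
    with bounded show "\<forall>\<^sub>F i in F. dist (blinfun_apply g \<bar>x i\<bar>) 0 < e"
    proof eventually_elim
      case (elim i)
      define z where "z = inverse C *\<^sub>R \<bar>x i\<bar>"
      have z: "0 \<le> z" "norm z \<le> 1" "\<bar>x i\<bar> = C *\<^sub>R z"
        using elim(1) C by (auto simp: z_def field_simps intro: scaleR_nonneg_nonneg)
      have "C *\<^sub>R inf z u \<le> inf \<bar>x i\<bar> (C *\<^sub>R u)"
        unfolding z(3) using C by (intro le_infI scaleR_left_mono) auto
      then have "C * blinfun_apply g (inf z u) \<le> blinfun_apply g (inf \<bar>x i\<bar> (C *\<^sub>R u))"
        using pos_blinfun_mono[OF g] by (metis blinfun.scaleR_right real_scaleR_def)
      moreover have "blinfun_apply g z = blinfun_apply g (inf z u) + blinfun_apply g (pprt (z - u))"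
        by (simp only: inf_add_pprt_diff flip: blinfun.add_right)
      moreover have "C * blinfun_apply g (pprt (z - u)) \<le> e / 2"
        using u(2)[OF z(1,2)] C by (simp add: field_simps)
      ultimately have "C * blinfun_apply g z < e"
        using elim(2) by (simp add: distrib_left)
      moreover have "0 \<le> C * blinfun_apply g z" using C pos_blinfun_nonneg[OF g z(1)] by simp
      ultimately show ?case unfolding z(3) by (simp add: blinfun.scaleR_right)
    qed
  qed
qed

subsection \<open>Components of a diffuse element\<close>

text \<open>Components act as the measurable subsets of \<open>u\<close>, with \<open>u - p\<close>
  as complement; a positive functional is then a finitely additive measure on them.\<close>

definition component :: "'a::banach_lattice \<Rightarrow> 'a \<Rightarrow> bool" where
  "component p u \<longleftrightarrow> 0 \<le> p \<and> p \<le> u \<and> inf p (u - p) = 0"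

lemma inf_eq_0I:
  fixes x y :: "'a::banach_lattice"
  shows "0 \<le> x \<Longrightarrow> 0 \<le> y \<Longrightarrow> inf x y \<le> 0 \<Longrightarrow> inf x y = 0"
  by (rule antisym) simp_all

lemma component_zero: "0 \<le> u \<Longrightarrow> component 0 u"
  by (simp add: component_def inf_absorb1)

lemma component_complement: "component p u \<Longrightarrow> component (u - p) u"
  by (simp add: component_def inf_commute)

text \<open>\<open>u - q\<close> splits into \<open>p - q\<close> and \<open>u - p\<close>, and
  \<open>q\<close> is disjoint from both.\<close>

lemma component_trans:
  assumes "component q p" "component p u"
  shows "component q u"
proof -
  have *: "0 \<le> q" "q \<le> p" "inf q (p - q) = 0" "0 \<le> p" "p \<le> u" "inf p (u - p) = 0"
    using assms by (auto simp: component_def)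
  have "inf q ((p - q) + (u - p)) \<le> inf q (p - q) + inf q (u - p)"
    using * by (intro inf_add_le) auto
  also have "inf q (u - p) = 0" using * by (intro inf_eq_0_mono[OF *(6)]) auto
  finally have "inf q (u - q) \<le> 0" using * by simp
  moreover have "q \<le> u" using *(2,5) by (rule order_trans)
  ultimately show ?thesis using *(1) by (simp add: component_def inf_eq_0I)
qed

lemma component_add:
  assumes "component p u" "component q (u - p)"
  shows "component (p + q) u"
proof -
  have *: "0 \<le> q" "q \<le> u - p" "inf q (u - p - q) = 0" "0 \<le> p" "p \<le> u" "inf p (u - p) = 0"
    using assms by (auto simp: component_def)
  have "inf p (u - p - q) = 0"
    using * by (intro inf_eq_0_mono[OF *(6)]) auto
  then have "inf (u - p - q) (p + q) \<le> 0"
    using inf_add_le[of "u - p - q" p q] * by (simp add: inf_commute)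
  then have "inf (u - p - q) (p + q) = 0"
    using * by (intro inf_eq_0I) simp_all
  then have "inf (p + q) (u - (p + q)) = 0"
    by (simp add: inf_commute diff_diff_eq)
  moreover have "p + q \<le> u" using *(2) by (simp add: le_diff_eq add.commute)
  ultimately show ?thesis using *(1,4) by (simp add: component_def)
qed

text \<open>By \<open>inf_add_le\<close> the overlap of \<open>v\<close> with \<open>p\<close> is at
  most \<open>p - P n\<close>, which tends to 0.\<close>

lemma inf_lim_eq_0:
  fixes p :: "'a::banach_lattice"
  assumes "P \<longlonglongrightarrow> p" "\<And>n. 0 \<le> P n" "\<And>n. P n \<le> p" "0 \<le> v" "\<And>n. inf (P n) v = 0"
  shows "inf p v = 0"
proof -
  have "inf v p \<le> p - P n" for n
  proof -
    have "inf v (P n + (p - P n)) \<le> inf v (P n) + inf v (p - P n)"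
      using assms by (intro inf_add_le) auto
    also have "\<dots> \<le> p - P n" using assms(5)[of n] by (simp add: inf_commute)
    finally show ?thesis by simp
  qed
  moreover have lim: "(\<lambda>n. p - P n) \<longlonglongrightarrow> 0" using tendsto_diff[OF tendsto_const assms(1), of p] by simp
  ultimately have "inf v p \<le> 0" by (intro lattice_LIMSEQ_ge[OF lim])
  moreover have "0 \<le> p" using assms(2,3) order_trans by blast
  ultimately show ?thesis using assms(4) by (simp only: inf_commute[of p] inf_eq_0I)
qed

lemma component_lim:
  fixes p :: "'a::banach_lattice"
  assumes "P \<longlonglongrightarrow> p" "\<And>n. P n \<le> p" "\<And>n. component (P n) u"
  shows "component p u"
proof -
  have P: "0 \<le> P n" "P n \<le> u" "inf (P n) (u - P n) = 0" for n
    using assms(3)[of n] by (auto simp: component_def)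
  have pu: "p \<le> u" using assms(1) P(2) by (rule lattice_LIMSEQ_le)
  have "inf (P n) (u - p) = 0" for n
    by (rule inf_eq_0_mono[OF P(3)[of n] P(1)]) (simp_all add: pu assms(2) diff_left_mono)
  then have "inf p (u - p) = 0"
    by (intro inf_lim_eq_0[OF assms(1) P(1) assms(2)]) (simp_all add: pu)
  then show ?thesis using pu order_trans[OF P(1) assms(2)] by (simp add: component_def)
qed

lemma abs_diff_disjoint:
  fixes a b :: "'a::banach_lattice"
  assumes "inf a b = 0"
  shows "\<bar>a - b\<bar> = a + b"
proof -
  have "pprt (a - b) = a" using inf_add_pprt_diff[of a b] assms by simp
  moreover have "pprt (- (a - b)) = b" using inf_add_pprt_diff[of b a] assms by (simp add: inf_commute)
  ultimately show ?thesis using pprt_add_pprt[of "a - b"] by simp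
qed

text \<open>The sequential form of order continuity: norm limits provide the suprema and infima used
  in the constructions on components.\<close>

locale monotone_complete =
  fixes ty :: "'a::banach_lattice itself"
  assumes decseq_convergent: "\<And>X :: nat \<Rightarrow> 'a. decseq X \<Longrightarrow> (\<And>n. 0 \<le> X n) \<Longrightarrow> convergent X"
begin

lemma incseq_lim:
  fixes X :: "nat \<Rightarrow> 'a"
  assumes "\<And>n. X n \<le> X (Suc n)" "\<And>n. X n \<le> u"
  obtains l where "X \<longlonglongrightarrow> l" "\<And>n. X n \<le> l" "l \<le> u"
proof -
  have "convergent (\<lambda>n. u - X n)"
    by (rule decseq_convergent) (use assms in \<open>auto simp: decseq_Suc_iff intro: diff_left_mono\<close>)
  then obtain m where m: "(\<lambda>n. u - X n) \<longlonglongrightarrow> m" by (auto simp: convergent_def)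
  have X: "X \<longlonglongrightarrow> u - m" using tendsto_diff[OF tendsto_const m, of u] by simp
  moreover have "incseq X" using assms by (simp add: incseq_Suc_iff)
  then have "X n \<le> u - m" for n
    using incseqD by (intro lattice_LIMSEQ_ge_from[OF X, of n]) blast
  moreover have "u - m \<le> u" using X assms(2) by (rule lattice_LIMSEQ_le)
  ultimately show thesis using that by blast
qed

text \<open>The element \<open>u\<close> is what remains of \<open>x\<close> after removing the largest \<open>y \<le> x\<close> with \<open>f y = 0\<close>.\<close>

lemma carrier_exists:
  fixes x :: 'a and f :: "'a \<Rightarrow>\<^sub>L real"
  assumes f: "0 \<le> f" and x: "0 \<le> x" "0 < blinfun_apply f x"
  obtains u where "0 < u" "u \<le> x" "\<And>y. 0 \<le> y \<Longrightarrow> y \<le> u \<Longrightarrow> blinfun_apply f y = 0 \<Longrightarrow> y = 0"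
proof -
  define D where "D = (\<lambda>y. x - y) ` {y. 0 \<le> y \<and> y \<le> x \<and> blinfun_apply f y = 0}"
  have D_iff: "d \<in> D \<longleftrightarrow> 0 \<le> d \<and> d \<le> x \<and> blinfun_apply f d = blinfun_apply f x" for d
  proof
    assume "0 \<le> d \<and> d \<le> x \<and> blinfun_apply f d = blinfun_apply f x"
    then have "x - d \<in> {y. 0 \<le> y \<and> y \<le> x \<and> blinfun_apply f y = 0}"
      by (auto simp: blinfun.diff_right diff_le_eq)
    then show "d \<in> D" unfolding D_def by (rule rev_image_eqI) simp
  qed (auto simp: D_def blinfun.diff_right diff_le_eq)
  have D: "directed_set D (\<ge>)"
    unfolding directed_set_def
  proof (intro conjI ballI)
    have "x \<in> D" using x by (simp add: D_iff)
    then show "D \<noteq> {}" by blast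
    fix d e assume de: "d \<in> D" "e \<in> D"
    \<comment> \<open>Members of \<open>D\<close> carry the full \<open>f\<close>-value of
      \<open>x\<close>, so passing from \<open>d\<close> to \<open>inf d e\<close> loses at most
      \<open>f (x - e) = 0\<close>.\<close>
    have "blinfun_apply f (pprt (d - e)) \<le> blinfun_apply f (x - e)"
      using de by (intro pos_blinfun_mono[OF f]) (simp add: D_iff pprt_def diff_right_mono)
    also have "\<dots> = 0" using de by (simp add: D_iff blinfun.diff_right)
    finally have "blinfun_apply f (pprt (d - e)) = 0"
      using pos_blinfun_nonneg[OF f zero_le_pprt] by (intro antisym)
    then have "blinfun_apply f (inf d e) = blinfun_apply f d"
      by (subst inf_add_pprt_diff[of d e, symmetric]) (simp only: blinfun.add_right)
    then have "inf d e \<in> D" using de by (auto simp: D_iff intro: le_infI1)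
    then show "\<exists>k\<in>D. k \<le> d \<and> k \<le> e" by (intro bexI[of _ "inf d e"]) auto
  qed (auto simp: reflp_on_def transp_on_def)
  obtain X u where X: "\<And>n. X n \<in> D" "X \<longlonglongrightarrow> u" and u: "\<And>d. d \<in> D \<Longrightarrow> u \<le> d"
  proof (rule directed_decseq_limit[OF decseq_convergent lattice_LIMSEQ_le D])
    show "0 \<le> d" if "d \<in> D" for d using that by (simp add: D_iff)
  qed blast+
  have X': "0 \<le> X n" "X n \<le> x" "blinfun_apply f (X n) = blinfun_apply f x" for n
    using X(1)[of n] by (auto simp: D_iff)
  have "(\<lambda>n. blinfun_apply f (X n)) \<longlonglongrightarrow> blinfun_apply f u"
    using X(2) by (intro blinfun.tendsto tendsto_const)
  then have fu: "blinfun_apply f u = blinfun_apply f x"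
    using X'(3) by (simp add: LIMSEQ_const_iff eq_commute)
  have u0: "0 \<le> u" using X(2) X'(1) by (rule lattice_LIMSEQ_ge)
  have ux: "u \<le> x" using X(2) X'(2) by (rule lattice_LIMSEQ_le)
  show thesis
  proof
    show "0 < u" using u0 fu x(2) by (auto simp: less_le blinfun.zero_right)
    show "u \<le> x" by (rule ux)
    fix y assume y: "0 \<le> y" "y \<le> u" "blinfun_apply f y = 0"
    \<comment> \<open>Removing an \<open>f\<close>-null \<open>y\<close> leads back into
      \<open>D\<close>, where \<open>u\<close> is a lower bound.\<close>
    have "u - y \<in> D"
      using y ux fu by (auto simp: D_iff blinfun.diff_right diff_le_eq intro: order_trans add_increasing2)
    then have "y \<le> 0" using u by force
    then show "y = 0" using y(1) by simp
  qed
qed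

text \<open>\<open>q\<close> is the band projection of \<open>p\<close> onto the band of
  \<open>w\<close>. Any overlap of \<open>p - q\<close> with \<open>w\<close> could be added to each
  cut without exceeding the next one, so in the limit it is 0.\<close>

lemma component_generated:
  fixes p w :: 'a
  assumes "0 \<le> p" "0 \<le> w"
  obtains q where "component q p" "inf p w \<le> q" "(\<lambda>n. inf p (real n *\<^sub>R w)) \<longlonglongrightarrow> q"
    "\<And>n. inf p (real n *\<^sub>R w) \<le> q"
proof -
  have nw: "0 \<le> real n *\<^sub>R w" for n using assms by (simp add: scaleR_nonneg_nonneg)
  have "inf p (real n *\<^sub>R w) \<le> inf p (real (Suc n) *\<^sub>R w)" for n
    using assms by (intro inf_mono scaleR_right_mono) auto
  then obtain q where q: "(\<lambda>n. inf p (real n *\<^sub>R w)) \<longlonglongrightarrow> q" "\<And>n. inf p (real n *\<^sub>R w) \<le> q" "q \<le> p"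
    using incseq_lim[of "\<lambda>n. inf p (real n *\<^sub>R w)" p] by auto
  have q0: "0 \<le> q" using q(2)[of 0] assms by (simp add: inf_absorb2)
  have "q + inf (p - q) w \<le> q"
  proof (rule lattice_LIMSEQ_le)
    show "(\<lambda>n. inf p (real n *\<^sub>R w) + inf (p - q) w) \<longlonglongrightarrow> q + inf (p - q) w"
      using q(1) by (intro tendsto_intros)
    fix n
    have "inf p (real n *\<^sub>R w) + inf (p - q) w \<le> q + (p - q)"
      using q(2) by (intro add_mono) auto
    moreover have "inf p (real n *\<^sub>R w) + inf (p - q) w \<le> real n *\<^sub>R w + w"
      by (intro add_mono) auto
    moreover have "real n *\<^sub>R w + w = real (Suc n) *\<^sub>R w" by (simp add: scaleR_add_left)
    ultimately have "inf p (real n *\<^sub>R w) + inf (p - q) w \<le> inf p (real (Suc n) *\<^sub>R w)"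
      by (intro le_infI) simp_all
    also have "\<dots> \<le> q" by (rule q(2))
    finally show "inf p (real n *\<^sub>R w) + inf (p - q) w \<le> q" .
  qed
  then have "inf (p - q) w = 0" using q(3) assms by (intro inf_eq_0I) simp_all
  then have disj: "inf (p - q) (real n *\<^sub>R w) = 0" for n
    using q(3) assms by (intro inf_scaleR_eq_0) auto
  have "inf q (p - q) = 0"
  proof (rule inf_lim_eq_0[OF q(1) _ q(2)])
    show "inf (inf p (real n *\<^sub>R w)) (p - q) = 0" for n
      using q(3) assms nw by (intro inf_eq_0_mono[OF disj[of n, unfolded inf_commute[of "p - q"]]]) auto
  qed (use q(3) assms nw in auto)
  then have "component q p" using q0 q(3) by (simp add: component_def)
  moreover have "inf p w \<le> q" using q(2)[of 1] by simp
  ultimately show thesis using that q by blast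
qed

text \<open>Cut a non-multiple \<open>y\<close> of \<open>p\<close> at a level
  \<open>t *\<^sub>R p\<close> that is neither above nor below it. The excess \<open>w\<close> and
  the deficit \<open>v\<close> are then nonzero and disjoint; the component generated by
  \<open>w\<close> is nonzero, and it misses \<open>v\<close>, hence is not
  \<open>p\<close>.\<close>

lemma non_atom_proper_component:
  fixes p :: 'a
  assumes "0 < p" "\<not> lattice_atom p"
  obtains q where "component q p" "q \<noteq> 0" "q \<noteq> p"
proof -
  have p0: "0 \<le> p" using assms by simp
  obtain y where y: "0 \<le> y" "y \<le> p" "\<And>t. y \<noteq> t *\<^sub>R p"
    using assms by (auto simp: lattice_atom_iff)
  obtain T where T: "0 \<le> T" "T *\<^sub>R p \<le> y" "\<And>s. s *\<^sub>R p \<le> y \<Longrightarrow> s \<le> T"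
    using largest_multiple[OF assms(1) y(1)] by blast
  \<comment> \<open>If \<open>y\<close> were below all these multiples, the limit would make it
    equal to \<open>T *\<^sub>R p\<close>.\<close>
  have "\<exists>n. \<not> y \<le> (T + inverse (real (Suc n))) *\<^sub>R p"
  proof (rule ccontr)
    assume "\<not> ?thesis"
    then have "y \<le> (T + inverse (real (Suc n))) *\<^sub>R p" for n by blast
    moreover have lim: "(\<lambda>n. (T + inverse (real (Suc n))) *\<^sub>R p) \<longlonglongrightarrow> (T + 0) *\<^sub>R p"
      by (intro tendsto_intros LIMSEQ_inverse_real_of_nat)
    ultimately have "y \<le> (T + 0) *\<^sub>R p" by (intro lattice_LIMSEQ_ge[OF lim])
    then show False using T(2) y(3)[of T] by simp
  qed
  then obtain n where n: "\<not> y \<le> (T + inverse (real (Suc n))) *\<^sub>R p" by blast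
  define t where "t = T + inverse (real (Suc n))"
  have t: "T < t" "0 \<le> t" using T(1) by (simp_all add: t_def add_nonneg_nonneg)
  define w where "w = pprt (y - t *\<^sub>R p)"
  define v where "v = pprt (t *\<^sub>R p - y)"
  have w0: "0 \<le> w" "w \<noteq> 0"
    using n le_zero_iff_zero_pprt[of "y - t *\<^sub>R p"] by (simp_all add: w_def t_def)
  have v0: "0 \<le> v" "v \<noteq> 0"
    using T(3)[of t] t le_zero_iff_zero_pprt[of "t *\<^sub>R p - y"] by (auto simp: v_def)
  have wv: "inf w v = 0"
    using inf_pprt_pprt[of "y - t *\<^sub>R p"] by (simp add: w_def v_def)
  have tp: "0 \<le> t *\<^sub>R p" using t p0 by (simp add: scaleR_nonneg_nonneg)
  have "w \<le> y" using y(1) tp by (simp add: w_def pprt_def diff_le_eq)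
  then have wp: "w \<le> p" using y(2) by simp
  have v_le: "v \<le> t *\<^sub>R p" using y(1) tp by (simp add: v_def pprt_def diff_le_eq)
  obtain q where q: "component q p" "inf p w \<le> q" "(\<lambda>n. inf p (real n *\<^sub>R w)) \<longlonglongrightarrow> q"
    "\<And>n. inf p (real n *\<^sub>R w) \<le> q"
    using component_generated[OF p0 w0(1)] by blast
  have "q \<noteq> 0" using q(2) wp w0 by (auto simp: inf_absorb2)
  moreover have "q \<noteq> p"
  proof
    assume "q = p"
    have nw: "0 \<le> real n *\<^sub>R w" for n using w0 by (simp add: scaleR_nonneg_nonneg)
    have "inf (inf p (real n *\<^sub>R w)) v = 0" for n
    proof (rule inf_eq_0_mono)
      show "inf (real n *\<^sub>R w) v = 0"
        using inf_scaleR_eq_0[of v w "real n"] v0 w0 wv by (simp add: inf_commute)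
    qed (use p0 nw v0 in auto)
    then have "inf q v = 0"
      using q(3,4) p0 nw v0 by (intro inf_lim_eq_0[OF q(3)]) auto
    then have "inf v (t *\<^sub>R p) = 0"
      using v0 p0 t \<open>q = p\<close> by (intro inf_scaleR_eq_0) (auto simp: inf_commute)
    then show False using v_le v0 by (simp add: inf_absorb1)
  qed
  ultimately show thesis using that q(1) by blast
qed

end

text \<open>The setting of a nonatomic measure: \<open>f\<close> is strictly positive on the nonzero
  pieces of \<open>u\<close>, and each such piece can be divided.\<close>

locale diffuse_element = monotone_complete ty for ty :: "'a::banach_lattice itself" +
  fixes f :: "'a \<Rightarrow>\<^sub>L real" and u :: 'a
  assumes f_pos: "0 \<le> f"
    and u_pos: "0 < u"
    and strict: "\<And>y. 0 \<le> y \<Longrightarrow> y \<le> u \<Longrightarrow> blinfun_apply f y = 0 \<Longrightarrow> y = 0"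
    and diffuse: "\<And>a. lattice_atom a \<Longrightarrow> \<not> a \<le> u"
begin

text \<open>Of a proper component and its complement, one has at most half of the
  \<open>f\<close>-value; iterate.\<close>

lemma small_component:
  assumes p: "0 \<le> p" "p \<le> u" "p \<noteq> 0" and "0 < e"
  obtains q where "component q p" "q \<noteq> 0" "blinfun_apply f q < e"
proof -
  have half: "\<exists>q. component q p \<and> q \<noteq> 0 \<and> blinfun_apply f q \<le> blinfun_apply f p / 2"
    if p: "0 \<le> p" "p \<le> u" "p \<noteq> 0" for p
  proof -
    have "0 < p" "\<not> lattice_atom p" using p diffuse by auto
    then obtain q where q: "component q p" "q \<noteq> 0" "q \<noteq> p"
      by (rule non_atom_proper_component)
    have "blinfun_apply f q + blinfun_apply f (p - q) = blinfun_apply f p"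
      by (simp add: blinfun.diff_right)
    then consider "blinfun_apply f q \<le> blinfun_apply f p / 2"
      | "blinfun_apply f (p - q) \<le> blinfun_apply f p / 2" by linarith
    then show ?thesis
      using q component_complement[OF q(1)] by cases (auto intro: exI[of _ q] exI[of _ "p - q"])
  qed
  have "\<exists>q. component q p \<and> q \<noteq> 0 \<and> blinfun_apply f q \<le> blinfun_apply f p / 2 ^ n" for n
  proof (induction n)
    case 0
    have "component p p" using p by (simp add: component_def inf_absorb2)
    then show ?case using p by auto
  next
    case (Suc n)
    then obtain q where q: "component q p" "q \<noteq> 0" "blinfun_apply f q \<le> blinfun_apply f p / 2 ^ n"
      by blast
    then obtain r where r: "component r q" "r \<noteq> 0" "blinfun_apply f r \<le> blinfun_apply f q / 2"
      using half[of q] p by (meson component_def order_trans)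
    have "blinfun_apply f r \<le> blinfun_apply f p / 2 ^ n / 2"
      by (rule order_trans[OF r(3) divide_right_mono[OF q(3)]]) simp
    then show ?case using r component_trans[OF r(1) q(1)] by (auto simp: mult.commute)
  qed
  moreover obtain n where "blinfun_apply f p / e < 2 ^ n"
    using real_arch_pow[of 2 "blinfun_apply f p / e"] by auto
  then have "blinfun_apply f p / 2 ^ n < e" using \<open>0 < e\<close> by (simp add: field_simps)
  ultimately show thesis using that by (meson le_less_trans)
qed

text \<open>Sierpinski's argument: enlarge \<open>q\<close> greedily, each step taking at least half of what can be
  added without exceeding \<open>t\<close>.\<close>

lemma component_of_measure:
  assumes p: "0 \<le> p" "p \<le> u" and t: "0 \<le> t" "t \<le> blinfun_apply f p"
  obtains q where "component q p" "blinfun_apply f q = t"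
proof -
  define adm where "adm q r \<longleftrightarrow> component r (p - q) \<and> blinfun_apply f q + blinfun_apply f r \<le> t" for q r
  have step: "\<exists>r. adm q r \<and> (\<forall>r'. adm q r' \<longrightarrow> blinfun_apply f r' \<le> 2 * blinfun_apply f r)"
    if q: "component q p" "blinfun_apply f q \<le> t" for q
  proof -
    define A where "A = blinfun_apply f ` {r. adm q r}"
    have zero: "adm q 0"
      using q component_zero[of "p - q"] by (simp add: adm_def component_def blinfun.zero_right)
    have bdd: "bdd_above A"
      using pos_blinfun_nonneg[OF f_pos] q
      by (intro bdd_aboveI[of _ t]) (force simp: A_def adm_def component_def)
    have le: "blinfun_apply f r \<le> Sup A" if "adm q r" for r
      using that by (intro cSup_upper bdd) (simp add: A_def)
    show ?thesis
    proof (cases "0 < Sup A")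
      case True
      then obtain s where "s \<in> A" "Sup A / 2 < s"
        using less_cSupE[of "Sup A / 2" A] zero by (auto simp: A_def)
      then show ?thesis using le by (force simp: A_def)
    next
      case False
      then have "blinfun_apply f r' \<le> 2 * blinfun_apply f 0" if "adm q r'" for r'
        using le[OF that] by (simp add: blinfun.zero_right)
      then show ?thesis using zero by blast
    qed
  qed
  define good where "good q \<longleftrightarrow> component q p \<and> blinfun_apply f q \<le> t" for q
  define next' where "next' q q' \<longleftrightarrow> q \<le> q' \<and>
    (\<forall>r'. adm q r' \<longrightarrow> blinfun_apply f r' \<le> 2 * (blinfun_apply f q' - blinfun_apply f q))" for q q'
  have "\<exists>q'. good q' \<and> next' q q'" if q: "good q" for q
  proof -
    obtain r where r: "adm q r" "\<And>r'. adm q r' \<Longrightarrow> blinfun_apply f r' \<le> 2 * blinfun_apply f r"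
      using step q by (auto simp: good_def)
    have "component (q + r) p" using q r(1) by (intro component_add) (auto simp: good_def adm_def)
    then have "good (q + r)" using r(1) by (simp add: good_def adm_def blinfun.add_right)
    moreover have "next' q (q + r)"
      using r by (auto simp: next'_def adm_def component_def blinfun.add_right)
    ultimately show ?thesis by blast
  qed
  moreover have "good 0" using p t component_zero by (simp add: good_def blinfun.zero_right)
  ultimately obtain Q where Q: "\<And>n. good (Q n)" "\<And>n. next' (Q n) (Q (Suc n))"
    using dependent_nat_choice[of "\<lambda>_. good" "\<lambda>_. next'"] by metis
  have Qc: "component (Q n) p" "blinfun_apply f (Q n) \<le> t" "Q n \<le> Q (Suc n)" for n
    using Q(1)[of n] Q(2)[of n] by (simp_all add: good_def next'_def)
  obtain q where q: "Q \<longlonglongrightarrow> q" "\<And>n. Q n \<le> q" "q \<le> p"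
    using incseq_lim[of Q p] Qc by (auto simp: component_def)
  have qc: "component q p" using q(1,2) Qc(1) by (rule component_lim)
  have flim: "(\<lambda>n. blinfun_apply f (Q n)) \<longlonglongrightarrow> blinfun_apply f q"
    using q(1) by (intro blinfun.tendsto tendsto_const)
  have "blinfun_apply f q \<le> t"
    by (rule LIMSEQ_le_const2[OF flim]) (use Qc(2) in blast)
  moreover have "\<not> blinfun_apply f q < t"
  proof
    assume lt: "blinfun_apply f q < t"
    then have "p - q \<noteq> 0" using t by auto
    moreover have "0 \<le> p - q" "p - q \<le> u"
      using qc p by (auto simp: component_def diff_le_eq intro: order_trans add_increasing2)
    \<comment> \<open>A piece \<open>r\<close> that fits into the missing measure is admissible at
      every stage, so each increment is at least \<open>f r / 2\<close>, although the increments
      tend to 0.\<close>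
    ultimately obtain r where r: "component r (p - q)" "r \<noteq> 0" "blinfun_apply f r < t - blinfun_apply f q"
      using small_component[of "p - q" "t - blinfun_apply f q"] lt by auto
    have rp: "0 \<le> r" "r \<le> u" using r(1) \<open>p - q \<le> u\<close> by (auto simp: component_def)
    have "adm (Q n) r" for n
    proof -
      have Qn: "0 \<le> Q n" using Qc(1) by (simp add: component_def)
      have "inf (p - q) (q - Q n) = 0"
      proof (rule inf_eq_0_mono)
        show "inf (p - q) q = 0" using qc by (simp add: component_def inf_commute)
      qed (use q Qn in simp_all)
      moreover have "p - Q n - (p - q) = q - Q n" by simp
      ultimately have "component (p - q) (p - Q n)"
        using q(2,3) unfolding component_def by (simp only: diff_left_mono diff_ge_0_iff_ge simp_thms)
      then have "component r (p - Q n)" using r(1) component_trans by blast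
      moreover have "blinfun_apply f (Q n) \<le> blinfun_apply f q"
        using q(2) by (rule pos_blinfun_mono[OF f_pos])
      ultimately show ?thesis using r(3) by (simp add: adm_def)
    qed
    then have le: "blinfun_apply f r \<le> 2 * (blinfun_apply f (Q (Suc n)) - blinfun_apply f (Q n))" for n
      using Q(2)[of n] by (simp add: next'_def)
    have "(\<lambda>n. 2 * (blinfun_apply f (Q (Suc n)) - blinfun_apply f (Q n))) \<longlonglongrightarrow>
        2 * (blinfun_apply f q - blinfun_apply f q)"
      by (intro tendsto_intros flim LIMSEQ_Suc[OF flim])
    then have "blinfun_apply f r \<le> 2 * (blinfun_apply f q - blinfun_apply f q)"
      using le by (intro LIMSEQ_le_const) auto
    then have "blinfun_apply f r = 0"
      using pos_blinfun_nonneg[OF f_pos rp(1)] by simp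
    then show False using strict rp r(2) by blast
  qed
  ultimately show thesis using that qc by force
qed

text \<open>The limsup argument: if \<open>f (y n) < 2^-n\<close>, the suprema \<open>W m\<close> of
  the tails decrease to some \<open>V\<close> with \<open>f V = 0\<close>. Strict positivity gives
  \<open>V = 0\<close>, while \<open>g (W m) \<ge> e\<close> throughout.\<close>

lemma absolutely_continuous:
  fixes g :: "'a \<Rightarrow>\<^sub>L real"
  assumes g: "0 \<le> g" and "0 < e"
  obtains d where "0 < d" "\<And>y. 0 \<le> y \<Longrightarrow> y \<le> u \<Longrightarrow> blinfun_apply f y < d \<Longrightarrow> blinfun_apply g y < e"
proof (rule ccontr)
  assume "\<not> thesis"
  then have "\<exists>y. 0 \<le> y \<and> y \<le> u \<and> blinfun_apply f y < (1/2) ^ n \<and> e \<le> blinfun_apply g y" for n :: nat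
    using that[of "(1/2) ^ n"] by (meson not_le zero_less_power half_gt_zero zero_less_one)
  then obtain y where y: "\<And>n. 0 \<le> y n" "\<And>n. y n \<le> u" "\<And>n. blinfun_apply f (y n) < (1/2) ^ n"
    "\<And>n. e \<le> blinfun_apply g (y n)"
    by metis
  \<comment> \<open>Finite suprema of \<open>y m, ..., y (m + k)\<close>, whose limit in
    \<open>k\<close> is the tail supremum.\<close>
  define S where "S m = rec_nat (y m) (\<lambda>k s. sup s (y (m + Suc k)))" for m
  have S_0: "S m 0 = y m" and S_Suc: "S m (Suc k) = sup (S m k) (y (m + Suc k))" for m k
    by (simp_all add: S_def)
  have S_le: "S m k \<le> u" for m k
    by (induction k) (simp_all add: S_0 S_Suc y)
  have S_ge: "y m \<le> S m k" for m k
    by (induction k) (auto simp: S_0 S_Suc intro: le_supI1)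
  \<comment> \<open>The extra power is the remaining geometric tail, which lets the induction
    close.\<close>
  have S_f: "blinfun_apply f (S m k) + (1/2) ^ (m + k) \<le> 2 * (1/2) ^ m" for m k
  proof (induction k)
    case (Suc k)
    have "S m (Suc k) \<le> S m k + y (m + Suc k)"
      unfolding S_Suc using y(1) order_trans[OF y(1) S_ge, of m k]
      by (intro le_supI) (auto simp: add_increasing add_increasing2)
    then have "blinfun_apply f (S m (Suc k)) \<le> blinfun_apply f (S m k) + blinfun_apply f (y (m + Suc k))"
      unfolding blinfun.add_right[symmetric] by (rule pos_blinfun_mono[OF f_pos])
    then show ?case using Suc y(3)[of "m + Suc k"] by simp
  qed (use y(3)[of m] in \<open>simp add: S_0\<close>)
  have S_shift: "S (Suc m) k \<le> S m (Suc k)" for m k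
    by (induction k) (auto simp: S_0 S_Suc intro: le_supI1)
  have "\<exists>W. S m \<longlonglongrightarrow> W \<and> (\<forall>k. S m k \<le> W) \<and> W \<le> u" for m
    using incseq_lim[of "S m" u] S_le S_Suc by (metis sup_ge1)
  then obtain W where W: "\<And>m. S m \<longlonglongrightarrow> W m" "\<And>m k. S m k \<le> W m" "\<And>m. W m \<le> u"
    by metis
  have yW: "y m \<le> W m" for m using W(2)[of m 0] by (simp add: S_0)
  have W0: "0 \<le> W m" for m using y(1) yW order_trans by blast
  have W_dec: "W (Suc m) \<le> W m" for m
    using W(1) by (rule lattice_LIMSEQ_le) (use S_shift W(2) order_trans in blast)
  have W_f: "blinfun_apply f (W m) \<le> 2 * (1/2) ^ m" for m
  proof (rule LIMSEQ_le_const2)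
    show "(\<lambda>k. blinfun_apply f (S m k)) \<longlonglongrightarrow> blinfun_apply f (W m)"
      using W(1) by (intro blinfun.tendsto tendsto_const)
    have "blinfun_apply f (S m k) \<le> 2 * (1/2) ^ m" for k
      using S_f[of m k] zero_le_power[of "1/2 :: real" "m + k"] by linarith
    then show "\<exists>N. \<forall>k\<ge>N. blinfun_apply f (S m k) \<le> 2 * (1/2) ^ m" by blast
  qed
  have "convergent W" using W_dec W0 by (intro decseq_convergent) (simp_all add: decseq_Suc_iff)
  then obtain V where V: "W \<longlonglongrightarrow> V" by (auto simp: convergent_def)
  have "0 \<le> V" using V W0 by (rule lattice_LIMSEQ_ge)
  have "V \<le> u" using V W(3) by (rule lattice_LIMSEQ_le)
  have "blinfun_apply f V \<le> 2 * 0"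
  proof (rule LIMSEQ_le)
    show "(\<lambda>m. blinfun_apply f (W m)) \<longlonglongrightarrow> blinfun_apply f V"
      using V by (intro blinfun.tendsto tendsto_const)
    show "(\<lambda>m. 2 * (1/2::real) ^ m) \<longlonglongrightarrow> 2 * 0"
      by (intro tendsto_intros LIMSEQ_realpow_zero) auto
  qed (use W_f in blast)
  then have "V = 0"
    using strict[OF \<open>0 \<le> V\<close> \<open>V \<le> u\<close>] pos_blinfun_nonneg[OF f_pos \<open>0 \<le> V\<close>] by simp
  have "(\<lambda>m. blinfun_apply g (W m)) \<longlonglongrightarrow> blinfun_apply g V"
    using V by (intro blinfun.tendsto tendsto_const)
  moreover have "e \<le> blinfun_apply g (W m)" for m
    using y(4)[of m] pos_blinfun_mono[OF g yW[of m]] by simp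
  ultimately have "e \<le> blinfun_apply g V" by (intro LIMSEQ_le_const) auto
  then show False using \<open>V = 0\<close> \<open>0 < e\<close> by (simp add: blinfun.zero_right)
qed

end

subsection \<open>A weakly null sequence of constant modulus\<close>

lemma sum_lessThan_double:
  fixes h :: "nat \<Rightarrow> 'b::comm_monoid_add"
  shows "sum h {..<2 * m} = (\<Sum>k<m. h (2 * k) + h (Suc (2 * k)))"
  by (induction m) (simp_all add: add.assoc)

context diffuse_element
begin

text \<open>\<open>r n\<close> is the \<open>n\<close>-th Rademacher function over a dyadic partition \<open>P n k\<close> (\<open>k < 2 ^ n\<close>) of \<open>u\<close>
  into components of equal \<open>f\<close>-measure. For \<open>0 \<le> g \<le> C f\<close> the energy
  \<open>2 ^ n * (\<Sum>k<2 ^ n. (g (P n k))\<^sup>2)\<close> is bounded, and by Cauchy-Schwarz it grows by at least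
  \<open>(g (r n))\<^sup>2\<close> in each step; hence \<open>g (r n) \<rightarrow> 0\<close>.\<close>

lemma rademacher_exists:
  obtains r :: "nat \<Rightarrow> 'a"
  where "\<And>n. \<bar>r n\<bar> = u"
    and "\<And>g C. 0 \<le> g \<Longrightarrow> (\<And>y. 0 \<le> y \<Longrightarrow> y \<le> u \<Longrightarrow> blinfun_apply g y \<le> C * blinfun_apply f y) \<Longrightarrow>
      (\<lambda>n. blinfun_apply (g :: 'a \<Rightarrow>\<^sub>L real) (r n)) \<longlonglongrightarrow> 0"
proof -
  have u0: "0 \<le> u" using u_pos by simp
  have "\<exists>q. component q p \<and> blinfun_apply f q = blinfun_apply f p / 2" if p: "0 \<le> p" "p \<le> u" for p
  proof -
    have "0 \<le> blinfun_apply f p" using f_pos p(1) by (rule pos_blinfun_nonneg)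
    then obtain q where "component q p" "blinfun_apply f q = blinfun_apply f p / 2"
      using component_of_measure[OF p, of "blinfun_apply f p / 2"] by auto
    then show ?thesis by blast
  qed
  then obtain H where "\<And>p. 0 \<le> p \<Longrightarrow> p \<le> u \<Longrightarrow> component (H p) p \<and> blinfun_apply f (H p) = blinfun_apply f p / 2"
    by metis
  then have H: "0 \<le> H p" "H p \<le> p" "inf (H p) (p - H p) = 0" "blinfun_apply f (H p) = blinfun_apply f p / 2"
    if "0 \<le> p" "p \<le> u" for p
    using that by (simp_all add: component_def)
  \<comment> \<open>Cell \<open>k\<close> has the children \<open>2 * k\<close> and
    \<open>2 * k + 1\<close>, a half and its complement.\<close>
  define P where "P = rec_nat (\<lambda>k :: nat. u) (\<lambda>n Q k. if even k then H (Q (k div 2)) else Q (k div 2) - H (Q (k div 2)))"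
  have P_0: "P 0 k = u"
    and P_even: "P (Suc n) (2 * k) = H (P n k)"
    and P_odd: "P (Suc n) (Suc (2 * k)) = P n k - H (P n k)"
    and P_Suc: "P (Suc n) k = (if even k then H (P n (k div 2)) else P n (k div 2) - H (P n (k div 2)))" for n k
    by (simp_all add: P_def)
  have P: "0 \<le> P n k \<and> P n k \<le> u \<and> blinfun_apply f (P n k) = blinfun_apply f u / 2 ^ n" for n k
  proof (induction n arbitrary: k)
    case (Suc n)
    note IH = Suc[of "k div 2"]
    have h: "0 \<le> H (P n (k div 2))" "H (P n (k div 2)) \<le> P n (k div 2)"
      "blinfun_apply f (H (P n (k div 2))) = blinfun_apply f (P n (k div 2)) / 2"
      using H[of "P n (k div 2)"] IH by blast+
    have "P n (k div 2) - H (P n (k div 2)) \<le> P n (k div 2)" using h(1) by simp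
    then have "P n (k div 2) - H (P n (k div 2)) \<le> u" "H (P n (k div 2)) \<le> u"
      using h(2) IH order_trans by blast+
    then show ?case using h IH by (simp add: P_Suc blinfun.diff_right)
  qed (use u0 in \<open>simp add: P_0\<close>)
  have HP: "0 \<le> H (P n k)" "H (P n k) \<le> P n k" "inf (H (P n k)) (P n k - H (P n k)) = 0" for n k
    using H P by blast+
  have P_disj: "inf (P n j) (P n k) = 0" if "j < 2 ^ n" "k < 2 ^ n" "j \<noteq> k" for n j k
    using that
  proof (induction n arbitrary: j k)
    case (Suc n)
    have *: "0 \<le> P (Suc n) i" "P (Suc n) i \<le> P n (i div 2)" for i
      using HP(1,2)[of n "i div 2"] by (simp_all add: P_Suc)
    show ?case
    proof (cases "j div 2 = k div 2")
      case True
      \<comment> \<open>Distinct indices with the same parent are its two halves.\<close>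
      then have "even j \<noteq> even k" using Suc.prems(3) by (metis bit_eq_rec even_iff_mod_2_eq_zero odd_iff_mod_2_eq_one mod_div_mult_eq)
      then show ?thesis using True HP(3)[of n "k div 2"] by (auto simp: P_Suc inf_commute)
    next
      case False
      have "inf (P n (j div 2)) (P n (k div 2)) = 0"
        using False Suc.prems by (intro Suc.IH) auto
      then show ?thesis by (rule inf_eq_0_mono) (use * in auto)
    qed
  qed simp
  have P_sum: "(\<Sum>k<2 ^ n. P n k) = u" for n
  proof (induction n)
    case (Suc n)
    then show ?case using sum_lessThan_double[of "P (Suc n)" "2 ^ n"] by (simp add: P_even P_odd)
  qed (simp add: P_0)
  define d where "d n k = H (P n k) - (P n k - H (P n k))" for n k
  define r where "r n = (\<Sum>k<2 ^ n. d n k)" for n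
  have r_abs: "\<bar>r n\<bar> = u" for n
  proof -
    \<comment> \<open>\<open>r n\<close> is the difference of two disjoint sums of halves that add
      up to \<open>u\<close>.\<close>
    let ?A = "\<Sum>k<2 ^ n. H (P n k)" and ?B = "\<Sum>k<2 ^ n. P n k - H (P n k)"
    have disj: "inf (H (P n j)) (P n k - H (P n k)) = 0" if "j < 2 ^ n" "k < 2 ^ n" for j k
    proof (cases "j = k")
      case False
      show ?thesis
        by (rule inf_eq_0_mono[OF P_disj[OF that False]]) (use HP(1,2) in simp_all)
    qed (use HP(3) in simp)
    have "inf ?A (P n k - H (P n k)) = 0" if "k < 2 ^ n" for k
    proof -
      have "inf (P n k - H (P n k)) ?A = 0"
        using disj that HP(1,2) by (intro inf_sum_eq_0) (simp_all add: inf_commute)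
      then show ?thesis by (simp add: inf_commute)
    qed
    then have "inf ?A ?B = 0"
      using HP(1,2) by (intro inf_sum_eq_0) (simp_all add: sum_nonneg)
    then have "\<bar>?A - ?B\<bar> = ?A + ?B" by (rule abs_diff_disjoint)
    also have "?A + ?B = u" by (simp add: P_sum flip: sum.distrib)
    finally show ?thesis by (simp add: r_def d_def sum_subtractf)
  qed
  have r_null: "(\<lambda>n. blinfun_apply g (r n)) \<longlonglongrightarrow> 0"
    if g: "0 \<le> g" and gC: "\<And>y. 0 \<le> y \<Longrightarrow> y \<le> u \<Longrightarrow> blinfun_apply g y \<le> C * blinfun_apply f y"
    for g :: "'a \<Rightarrow>\<^sub>L real" and C
  proof -
    define E where "E n = 2 ^ n * (\<Sum>k<2 ^ n. (blinfun_apply g (P n k))\<^sup>2)" for n :: nat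
    have step: "E (Suc n) = E n + 2 ^ n * (\<Sum>k<2 ^ n. (blinfun_apply g (d n k))\<^sup>2)" for n
    proof -
      \<comment> \<open>The parallelogram identity for the values of \<open>g\<close> on the two
        halves.\<close>
      have "2 * ((blinfun_apply g (P (Suc n) (2 * k)))\<^sup>2 + (blinfun_apply g (P (Suc n) (Suc (2 * k))))\<^sup>2) =
          (blinfun_apply g (P n k))\<^sup>2 + (blinfun_apply g (d n k))\<^sup>2" for k
        by (simp only: P_even P_odd d_def blinfun.diff_right) (simp add: power2_eq_square algebra_simps)
      then have "2 * (\<Sum>k<2 ^ Suc n. (blinfun_apply g (P (Suc n) k))\<^sup>2) =
          (\<Sum>k<2 ^ n. (blinfun_apply g (P n k))\<^sup>2 + (blinfun_apply g (d n k))\<^sup>2)"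
        using sum_lessThan_double[of "\<lambda>k. (blinfun_apply g (P (Suc n) k))\<^sup>2" "2 ^ n"]
        by (simp add: sum_distrib_left)
      moreover have "E (Suc n) = 2 ^ n * (2 * (\<Sum>k<2 ^ Suc n. (blinfun_apply g (P (Suc n) k))\<^sup>2))"
        by (simp add: E_def)
      ultimately show ?thesis
        by (simp only: E_def sum.distrib distrib_left)
    qed
    have ge: "(blinfun_apply g (r n))\<^sup>2 \<le> E (Suc n) - E n" for n
      using sum_squared_le_sum_of_squares[of "\<lambda>k. blinfun_apply g (d n k)" "{..<2 ^ n}"]
      by (simp add: step r_def blinfun.sum_right mult.commute)
    have g0: "0 \<le> blinfun_apply g (P n k)" for n k using pos_blinfun_nonneg[OF g] P by blast
    have bound: "E n \<le> C * blinfun_apply f u * blinfun_apply g u" for n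
    proof -
      have "E n = (\<Sum>k<2 ^ n. 2 ^ n * (blinfun_apply g (P n k) * blinfun_apply g (P n k)))"
        by (simp add: E_def sum_distrib_left power2_eq_square)
      also have "\<dots> \<le> (\<Sum>k<2 ^ n. C * blinfun_apply f u * blinfun_apply g (P n k))"
      proof (rule sum_mono)
        fix k
        \<comment> \<open>Equal \<open>f\<close>-measure of the cells bounds one factor uniformly;
          the other factor sums to \<open>g u\<close>.\<close>
        have "blinfun_apply g (P n k) \<le> C * (blinfun_apply f u / 2 ^ n)"
          using gC[of "P n k"] P[of n k] by simp
        then have "2 ^ n * blinfun_apply g (P n k) \<le> C * blinfun_apply f u"
          by (simp add: field_simps)
        then show "2 ^ n * (blinfun_apply g (P n k) * blinfun_apply g (P n k)) \<le>
            C * blinfun_apply f u * blinfun_apply g (P n k)"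
          using mult_right_mono[OF _ g0[of n k]] by (simp only: mult.assoc[symmetric])
      qed
      also have "\<dots> = C * blinfun_apply f u * blinfun_apply g u"
        by (simp add: P_sum flip: sum_distrib_left blinfun.sum_right)
      finally show ?thesis .
    qed
    have E0: "0 \<le> E 0" by (simp add: E_def)
    have "summable (\<lambda>n. (blinfun_apply g (r n))\<^sup>2)"
    proof (rule bounded_imp_summable)
      fix n
      have "(\<Sum>k\<le>n. (blinfun_apply g (r k))\<^sup>2) \<le> (\<Sum>k<Suc n. E (Suc k) - E k)"
        unfolding lessThan_Suc_atMost by (intro sum_mono ge)
      also have "\<dots> = E (Suc n) - E 0" by (rule sum_lessThan_telescope)
      also have "\<dots> \<le> C * blinfun_apply f u * blinfun_apply g u"
        using bound[of "Suc n"] E0 by linarith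
      finally show "(\<Sum>k\<le>n. (blinfun_apply g (r k))\<^sup>2) \<le> C * blinfun_apply f u * blinfun_apply g u" .
    qed simp
    then have "(\<lambda>n. (blinfun_apply g (r n))\<^sup>2) \<longlonglongrightarrow> 0" by (rule summable_LIMSEQ_zero)
    from tendsto_real_sqrt[OF this] show ?thesis by (simp add: tendsto_rabs_zero_iff)
  qed
  show thesis using r_abs r_null by (rule that)
qed

text \<open>By absolute continuity \<open>(g - C f)\<^sup>+\<close> is small at \<open>u\<close> for large \<open>C\<close>, which reduces a positive \<open>g\<close> to
  functionals below a multiple of \<open>f\<close>.\<close>

lemma weak_null_modulus_const:
  obtains r :: "nat \<Rightarrow> 'a" where "\<And>n. \<bar>r n\<bar> = u" "weak_tendsto r 0 sequentially"
proof -
  obtain r :: "nat \<Rightarrow> 'a" where r: "\<And>n. \<bar>r n\<bar> = u"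
    and null: "\<And>g C. 0 \<le> g \<Longrightarrow> (\<And>y. 0 \<le> y \<Longrightarrow> y \<le> u \<Longrightarrow> blinfun_apply g y \<le> C * blinfun_apply f y) \<Longrightarrow>
      (\<lambda>n. blinfun_apply (g :: 'a \<Rightarrow>\<^sub>L real) (r n)) \<longlonglongrightarrow> 0"
    using rademacher_exists by blast
  have u0: "0 \<le> u" using u_pos by simp
  have pos: "(\<lambda>n. blinfun_apply g (r n)) \<longlonglongrightarrow> 0" if g: "0 \<le> g" for g :: "'a \<Rightarrow>\<^sub>L real"
  proof (rule LIMSEQ_I)
    fix e :: real assume "0 < e"
    then have e: "0 < e / 2" by simp
    obtain \<delta> where \<delta>: "0 < \<delta>"
      "\<And>y. 0 \<le> y \<Longrightarrow> y \<le> u \<Longrightarrow> blinfun_apply f y < \<delta> \<Longrightarrow> blinfun_apply g y < e / 2"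
      using absolutely_continuous[OF g e] by blast
    \<comment> \<open>With this \<open>C\<close>, \<open>C * f y \<ge> g u \<ge> g y\<close>
      whenever \<open>f y \<ge> \<delta>\<close>; otherwise \<open>g y\<close> itself is below
      \<open>e / 2\<close>.\<close>
    define C where "C = blinfun_apply g u / \<delta>"
    have C0: "0 \<le> C" using \<delta>(1) pos_blinfun_nonneg[OF g u0] by (simp add: C_def)
    define \<psi> where "\<psi> = g - C *\<^sub>R f"
    have \<psi>: "blinfun_apply \<psi> y = blinfun_apply g y - C * blinfun_apply f y" for y
      by (simp add: \<psi>_def blinfun.diff_left blinfun.scaleR_left)
    obtain p where p: "0 \<le> p" "\<psi> \<le> p"
      "\<And>x c. 0 \<le> x \<Longrightarrow> (\<And>y. 0 \<le> y \<Longrightarrow> y \<le> x \<Longrightarrow> blinfun_apply \<psi> y \<le> c) \<Longrightarrow> blinfun_apply p x \<le> c"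
      using positive_part_blinfun[of \<psi>] by blast
    have pu: "blinfun_apply p u \<le> e / 2"
    proof (rule p(3)[OF u0])
      fix y assume y: "0 \<le> y" "y \<le> u"
      have fy: "0 \<le> blinfun_apply f y" using pos_blinfun_nonneg[OF f_pos y(1)] .
      have gy: "blinfun_apply g y \<le> C * \<delta>" using pos_blinfun_mono[OF g y(2)] \<delta>(1) by (simp add: C_def)
      show "blinfun_apply \<psi> y \<le> e / 2"
      proof (cases "blinfun_apply f y < \<delta>")
        case True
        then show ?thesis using \<delta>(2)[OF y] C0 fy mult_nonneg_nonneg[OF C0 fy] unfolding \<psi> by linarith
      next
        case False
        then have "C * \<delta> \<le> C * blinfun_apply f y" using C0 by (intro mult_left_mono) auto
        then show ?thesis using gy e unfolding \<psi> by linarith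
      qed
    qed
    \<comment> \<open>As \<open>p\<close> is the positive part of \<open>g - C f\<close>, the
      difference \<open>g - p\<close> is the infimum of \<open>g\<close> and \<open>C f\<close> in
      the dual.\<close>
    have "0 \<le> g - p"
      unfolding pos_blinfun_iff
    proof (intro allI impI)
      fix x :: 'a assume x: "0 \<le> x"
      have "blinfun_apply p x \<le> blinfun_apply g x"
      proof (rule p(3)[OF x])
        fix y assume y: "0 \<le> y" "y \<le> x"
        have "0 \<le> C * blinfun_apply f y"
          using C0 pos_blinfun_nonneg[OF f_pos y(1)] by (rule mult_nonneg_nonneg)
        then show "blinfun_apply \<psi> y \<le> blinfun_apply g x"
          using pos_blinfun_mono[OF g y(2)] unfolding \<psi> by linarith
      qed
      then show "0 \<le> blinfun_apply (g - p) x" by (simp add: blinfun.diff_left)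
    qed
    moreover have "blinfun_apply (g - p) y \<le> C * blinfun_apply f y" if "0 \<le> y" for y
    proof -
      have "blinfun_apply \<psi> y \<le> blinfun_apply p y" using p(2) that by (simp add: less_eq_blinfun_def)
      then show ?thesis unfolding \<psi> by (simp add: blinfun.diff_left)
    qed
    ultimately have "(\<lambda>n. blinfun_apply (g - p) (r n)) \<longlonglongrightarrow> 0" by (intro null)
    then obtain N where N: "\<And>n. N \<le> n \<Longrightarrow> \<bar>blinfun_apply (g - p) (r n)\<bar> < e / 2"
      using LIMSEQ_D[of "\<lambda>n. blinfun_apply (g - p) (r n)" 0 "e / 2"] e by auto
    have "norm (blinfun_apply g (r n) - 0) < e" if "N \<le> n" for n
    proof -
      have "\<bar>blinfun_apply p (r n)\<bar> \<le> e / 2"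
        using pos_blinfun_abs[OF p(1), of "r n"] pu unfolding r by linarith
      moreover have "blinfun_apply g (r n) = blinfun_apply (g - p) (r n) + blinfun_apply p (r n)"
        by (simp add: blinfun.diff_left)
      ultimately show ?thesis using N[OF that] unfolding real_norm_def by linarith
    qed
    then show "\<exists>N. \<forall>n\<ge>N. norm (blinfun_apply g (r n) - 0) < e" by blast
  qed
  have "weak_tendsto r 0 sequentially"
    unfolding weak_tendsto_def
  proof
    fix g :: "'a \<Rightarrow>\<^sub>L real"
    obtain p where p: "0 \<le> p" "g \<le> p" by (rule positive_part_blinfun)
    have "0 \<le> p - g" using p(2) by (simp add: less_eq_blinfun_def blinfun.diff_left)
    from tendsto_diff[OF pos[OF p(1)] pos[OF this]]
    show "(\<lambda>n. blinfun_apply g (r n)) \<longlonglongrightarrow> blinfun_apply g 0"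
      by (simp add: blinfun.diff_left blinfun.zero_right)
  qed
  with r show thesis by (rule that)
qed

end

subsection \<open>The equivalences\<close>

lemma weak_null_un_null_imp_discrete:
  assumes wu: "\<And>x :: nat \<Rightarrow> 'a::banach_lattice. bounded (range x) \<Longrightarrow> weak_tendsto x 0 sequentially \<Longrightarrow>
      un_tendsto x 0 sequentially"
    and conv: "\<And>X :: nat \<Rightarrow> 'a. decseq X \<Longrightarrow> (\<And>n. 0 \<le> X n) \<Longrightarrow> convergent X"
  shows "discrete_lattice TYPE('a)"
  unfolding discrete_lattice_def
proof (intro allI impI, rule ccontr)
  fix x :: 'a assume x: "0 < x" and no_atom: "\<nexists>a. lattice_atom a \<and> a \<le> x"
  \<comment> \<open>Truncation at \<open>v\<close> shows that \<open>r\<close> is not un-null. For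
    the constant sequence this supplies a functional, for the Rademacher sequence the
    contradiction.\<close>
  have no_weak: "\<not> weak_tendsto r 0 sequentially" if r: "\<And>n. \<bar>r n\<bar> = v" and v: "0 < v" for r :: "nat \<Rightarrow> 'a" and v
  proof
    assume weak: "weak_tendsto r 0 sequentially"
    have "norm (r n) = norm v" for n using r[of n] by (metis norm_abs)
    then have "bounded (range r)" by (auto simp: bounded_iff)
    then have "un_tendsto r 0 sequentially" using weak by (rule wu)
    then have "(\<lambda>n. norm (inf \<bar>r n - 0\<bar> v)) \<longlonglongrightarrow> 0" using v by (simp add: un_tendsto_def)
    then show False using v by (simp add: r LIMSEQ_const_iff)
  qed
  interpret monotone_complete "TYPE('a)" by unfold_locales (rule conv)
  have "\<not> weak_tendsto (\<lambda>n::nat. x) 0 sequentially" using x by (intro no_weak[of _ x]) auto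
  then obtain h :: "'a \<Rightarrow>\<^sub>L real" where "blinfun_apply h x \<noteq> 0"
    by (auto simp: weak_tendsto_def LIMSEQ_const_iff blinfun.zero_right)
  moreover obtain f :: "'a \<Rightarrow>\<^sub>L real" where f: "0 \<le> f" "\<And>x. \<bar>blinfun_apply h x\<bar> \<le> blinfun_apply f \<bar>x\<bar>"
    by (rule modulus_majorant) blast
  ultimately have "0 < blinfun_apply f x" using f(2)[of x] x by simp
  then obtain u where u: "0 < u" "u \<le> x" "\<And>y. 0 \<le> y \<Longrightarrow> y \<le> u \<Longrightarrow> blinfun_apply f y = 0 \<Longrightarrow> y = 0"
    using carrier_exists[OF f(1) less_imp_le[OF x]] by blast
  interpret diffuse_element "TYPE('a)" f u
    by unfold_locales (use f u no_atom order_trans in blast)+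
  obtain r :: "nat \<Rightarrow> 'a" where "\<And>n. \<bar>r n\<bar> = u" "weak_tendsto r 0 sequentially"
    by (rule weak_null_modulus_const) blast
  then show False using no_weak u(1) by blast
qed

context
  fixes ty :: "'a::banach_lattice itself"
  assumes un_iff_weak: "\<And>x :: nat \<Rightarrow> 'a. bounded (range x) \<Longrightarrow>
    un_tendsto x 0 sequentially \<longleftrightarrow> weak_tendsto x 0 sequentially"
begin

text \<open>\<open>y\<close> is weakly null, hence un-null, and truncation at \<open>u\<close>
  leaves each \<open>y n\<close> unchanged.\<close>

lemma sum_bounded_null:
  fixes y :: "nat \<Rightarrow> 'a"
  assumes y: "\<And>n. 0 \<le> y n" "\<And>N. sum y {..<N} \<le> u"
  shows "y \<longlonglongrightarrow> 0"
proof -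
  have y_le: "y n \<le> u" for n
  proof -
    have "y n \<le> sum y {..<Suc n}" using y(1) by (simp add: sum_nonneg)
    also have "\<dots> \<le> u" by (rule y(2))
    finally show ?thesis .
  qed
  have u: "0 \<le> u" using y(2)[of 0] by simp
  have "bounded (range y)"
    using norm_mono_nonneg[OF y(1) y_le] by (auto simp: bounded_iff)
  then have un: "un_tendsto y 0 sequentially"
    using weak_null_sum_bounded[OF y] by (simp add: un_iff_weak)
  have "inf \<bar>y n - 0\<bar> u = y n" for n using y(1) y_le by (simp add: inf_absorb1)
  then show ?thesis
    using un[unfolded un_tendsto_def, rule_format, OF u] by (simp add: tendsto_norm_zero_iff)
qed

text \<open>The truncations of \<open>w\<close> at any \<open>u\<close> are again disjoint, so their
  partial sums stay below \<open>u\<close> and \<open>sum_bounded_null\<close> applies; thus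
  \<open>w\<close> is un-null and by hypothesis weakly null.\<close>

lemma disjoint_null:
  fixes f :: "'a \<Rightarrow>\<^sub>L real" and w :: "nat \<Rightarrow> 'a"
  assumes w: "\<And>n. 0 \<le> w n" "\<And>n. norm (w n) \<le> 1" "\<And>m n. m \<noteq> n \<Longrightarrow> inf (w m) (w n) = 0"
  shows "(\<lambda>n. blinfun_apply f (w n)) \<longlonglongrightarrow> 0"
proof -
  have "un_tendsto w 0 sequentially"
    unfolding un_tendsto_def
  proof (intro allI impI)
    fix u :: 'a assume u: "0 \<le> u"
    have "(\<lambda>n. inf (w n) u) \<longlonglongrightarrow> 0"
    proof (rule sum_bounded_null)
      show "(\<Sum>n<N. inf (w n) u) \<le> u" for N
      proof (rule sum_disjoint_le)
        show "inf (inf (w i) u) (inf (w j) u) = 0" if "i \<noteq> j" for i j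
          by (rule inf_eq_0_mono[OF w(3)[OF that]]) (use u w(1) in auto)
      qed (use u w(1) in auto)
    qed (use u w(1) in auto)
    then show "(\<lambda>n. norm (inf \<bar>w n - 0\<bar> u)) \<longlonglongrightarrow> 0"
      using w(1) by (simp add: tendsto_norm_zero_iff)
  qed
  moreover have "bounded (range w)" using w(2) by (auto simp: bounded_iff)
  ultimately have "weak_tendsto w 0 sequentially" by (simp add: un_iff_weak)
  then show ?thesis by (auto simp: weak_tendsto_def blinfun.zero_right)
qed

lemma discrete_order_continuous:
  "discrete_lattice TYPE('a) \<and> order_continuous_norm TYPE('a) \<and> order_continuous_norm TYPE('a \<Rightarrow>\<^sub>L real)"
proof (intro conjI)
  have conv: "convergent X" if "decseq X" "\<And>n. 0 \<le> X n" for X :: "nat \<Rightarrow> 'a"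
    using sum_bounded_null that by (rule banach_lattice_decseq_convergent)
  show "discrete_lattice TYPE('a)"
    by (rule weak_null_un_null_imp_discrete) (use un_iff_weak conv in blast)+
  show "order_continuous_norm TYPE('a)"
    using conv lattice_LIMSEQ_le lattice_LIMSEQ_ge norm_mono_nonneg by (rule order_continuous_normI)
  show "order_continuous_norm TYPE('a \<Rightarrow>\<^sub>L real)"
    by (rule order_continuous_norm_dualI) (rule disjoint_null)
qed

end

text \<open>A copy of the natural numbers inside \<open>'i\<close>, ordered through
  \<open>k\<close>, turns every sequence into a net with indices in \<open>'i\<close>.\<close>

lemma infinite_type_sequence_net:
  assumes "infinite (UNIV :: 'i set)"
  obtains h :: "nat \<Rightarrow> 'i" and k :: "'i \<Rightarrow> nat" and le where "\<And>n. k (h n) = n"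
    "directed_set (range h) le" "tails (range h) le = filtermap h sequentially"
proof -
  obtain h :: "nat \<Rightarrow> 'i" where h: "inj h"
    using infinite_countable_subset[OF assms] by blast
  define k where "k = inv h"
  define le where "le i j \<longleftrightarrow> k i \<le> k j" for i j
  have kh: "k (h n) = n" for n using h by (simp add: k_def)
  have dir: "directed_set (range h) le"
    unfolding directed_set_def
  proof (intro conjI ballI)
    fix i j assume "i \<in> range h" "j \<in> range h"
    then show "\<exists>l\<in>range h. le i l \<and> le j l"
      by (intro bexI[of _ "h (max (k i) (k j))"]) (auto simp: le_def kh)
  qed (auto simp: le_def reflp_on_def transp_on_def)
  have "tails (range h) le = filtermap h sequentially"
    unfolding filter_eq_iff eventually_tails[OF dir] eventually_filtermap eventually_sequentially
    by (auto simp: le_def kh)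
  then show thesis using that kh dir by blast
qed

lemma tendsto_notions_filtermap:
  "un_tendsto x l (filtermap h F) \<longleftrightarrow> un_tendsto (x \<circ> h) l F"
  "weak_tendsto x l (filtermap h F) \<longleftrightarrow> weak_tendsto (x \<circ> h) l F"
  "uaw_tendsto x l (filtermap h F) \<longleftrightarrow> uaw_tendsto (x \<circ> h) l F"
  by (simp_all add: un_tendsto_def weak_tendsto_def uaw_tendsto_def filterlim_filtermap comp_def)

lemma all_equivalent5I:
  assumes "P1 \<Longrightarrow> P2" "P2 \<Longrightarrow> P3" "P2 \<Longrightarrow> P4" "P3 \<Longrightarrow> P5" "P4 \<Longrightarrow> P5" "P5 \<Longrightarrow> P1"
  shows "all_equivalent [P1, P2, P3, P4, P5]"
proof -
  have "P1 = P5" "P2 = P5" "P3 = P5" "P4 = P5" using assms by blast+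
  then show ?thesis by (simp add: all_equivalent_def)
qed

theorem corollary2p6:
  assumes "infinite (UNIV :: 'i set)"
  shows "all_equivalent
    [discrete_lattice TYPE('a::banach_lattice) \<and>
       order_continuous_norm TYPE('a) \<and> order_continuous_norm TYPE('a \<Rightarrow>\<^sub>L real),
     \<forall>(I :: 'i set) le (x :: 'i \<Rightarrow> 'a). directed_set I le \<and> bounded (x ` I) \<longrightarrow>
       (un_tendsto x 0 (tails I le) \<longleftrightarrow> uaw_tendsto x 0 (tails I le)) \<and>
       (uaw_tendsto x 0 (tails I le) \<longleftrightarrow> weak_tendsto x 0 (tails I le)),
     \<forall>x :: nat \<Rightarrow> 'a. bounded (range x) \<longrightarrow>
       (weak_tendsto x 0 sequentially \<longleftrightarrow> uaw_tendsto x 0 sequentially) \<and>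
       (uaw_tendsto x 0 sequentially \<longleftrightarrow> un_tendsto x 0 sequentially),
     \<forall>(I :: 'i set) le (x :: 'i \<Rightarrow> 'a). directed_set I le \<and> bounded (x ` I) \<longrightarrow>
       (un_tendsto x 0 (tails I le) \<longleftrightarrow> weak_tendsto x 0 (tails I le)),
     \<forall>x :: nat \<Rightarrow> 'a. bounded (range x) \<longrightarrow>
       (un_tendsto x 0 sequentially \<longleftrightarrow> weak_tendsto x 0 sequentially)]"
    (is "all_equivalent [?P1, ?P2, ?P3, ?P4, ?P5]")
proof -
  obtain h :: "nat \<Rightarrow> 'i" and k :: "'i \<Rightarrow> nat" and le where kh: "\<And>n. k (h n) = n"
    and dir: "directed_set (range h) le" and tails: "tails (range h) le = filtermap h sequentially"
    by (rule infinite_type_sequence_net[OF assms]) blast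
  \<comment> \<open>A sequence \<open>x\<close> becomes the net \<open>x \<circ> k\<close> on
    \<open>range h\<close>; pulling it back along \<open>h\<close> returns \<open>x\<close>.\<close>
  have comp: "(x \<circ> k) \<circ> h = x" for x :: "nat \<Rightarrow> 'a" by (auto simp: kh)
  have bdd: "bounded ((x \<circ> k) ` range h)" if "bounded (range x)" for x :: "nat \<Rightarrow> 'a"
    using that by (rule bounded_subset) auto
  have "?P2" if P1: ?P1
  proof (intro allI impI, elim conjE)
    fix I :: "'i set" and le and x :: "'i \<Rightarrow> 'a"
    assume I: "directed_set I le" and x: "bounded (x ` I)"
    obtain B where "\<And>i. i \<in> I \<Longrightarrow> norm (x i) \<le> B" using x by (auto simp: bounded_iff)
    then have "\<forall>\<^sub>F i in tails I le. norm (x i) \<le> B"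
      using I unfolding eventually_tails[OF I] by (auto simp: directed_set_def)
    then show "(un_tendsto x 0 (tails I le) \<longleftrightarrow> uaw_tendsto x 0 (tails I le)) \<and>
       (uaw_tendsto x 0 (tails I le) \<longleftrightarrow> weak_tendsto x 0 (tails I le))"
      using P1 un_null_weak_null weak_null_un_null uaw_null_un_null un_null_uaw_null by blast
  qed
  moreover have "?P3" if ?P2
  proof (intro allI impI)
    fix x :: "nat \<Rightarrow> 'a" assume "bounded (range x)"
    with \<open>?P2\<close>[rule_format, OF conjI[OF dir bdd], of x]
    show "(weak_tendsto x 0 sequentially \<longleftrightarrow> uaw_tendsto x 0 sequentially) \<and>
       (uaw_tendsto x 0 sequentially \<longleftrightarrow> un_tendsto x 0 sequentially)"
      unfolding tails tendsto_notions_filtermap comp by blast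
  qed
  moreover have ?P4 if ?P2 using that by blast
  moreover have ?P5 if ?P3 using that by blast
  moreover have ?P5 if ?P4
  proof (intro allI impI)
    fix x :: "nat \<Rightarrow> 'a" assume "bounded (range x)"
    with \<open>?P4\<close>[rule_format, OF conjI[OF dir bdd], of x]
    show "un_tendsto x 0 sequentially \<longleftrightarrow> weak_tendsto x 0 sequentially"
      unfolding tails tendsto_notions_filtermap comp by blast
  qed
  moreover have ?P1 if ?P5
    by (rule discrete_order_continuous) (use that in blast)
  ultimately show ?thesis by (intro all_equivalent5I)
qed

end
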